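(* Let $p_0$ be a pmf on $\mathbb{N}$ whose support is $\{0,\dots,S\}$ for some integer $S>0$, and assume $p_0$ is convex on $\mathbb{N}$. Let $X_1,\dots,X_n$ be i.i.d. with pmf $p_0$. Let $(v_n)_{n\in\mathbb{N}}$ be positive numbers with $v_n\to0$ and $\sqrt n\, v_n\to\infty$. Define $S_n$, $g_n$, $\mathcal K_n$ as below and let $\hat g_n$ be the minimizer of $\sum_{k=0}^{S_n+1}(g(k)-g_n(k))^2$ over $g\in\mathcal K_n$. Then $\hat g_n$ exists and is unique, both $\hat g_n$ and $\hat T_n:=\sum_{k=0}^{S_n+1}(\hat g_n(k)-g_n(k))^2$ are measurable, and conditionally on $X_1,\dots,X_n$, $\hat T_n$ converges in distribution to $\hat T_0:=\sum_{k=0}^{S+1}(\hat g_0(k)-g_0(k))^2$ in probability as $n\to\infty$.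
   Context: $p_n(j)=n^{-1}\sum_{i=1}^n\mathbb{1}_{\{X_i=j\}}$ is the empirical pmf and $S_n=\max\{X_1,\dots,X_n\}$. For a sequence $p$ and $k\ge1$, $\Delta p(k)=p(k+1)-2p(k)+p(k-1)$ (same formula for finite vectors $g$ at interior indices); $p$ is convex on $\mathbb{N}$ iff $\Delta p(k)\ge0$ for all $k\ge1$; $k\ge1$ is a knot of $p$ if $\Delta p(k)>0$. $\hat p_n$ is the (unique) minimizer of $\sum_{j}(p_n(j)-p(j))^2$ over all convex pmfs $p$ on $\mathbb{N}$. Conditionally on $X_1,\dots,X_n$, $g_n=(g_n(0),\dots,g_n(S_n+1))$ is a centered Gaussian vector in $\mathbb{R}^{S_n+2}$ with covariance entries $\mathbb{1}_{\{i=j\}}p_n(i)-p_n(i)p_n(j)$, $i,j=0,\dots,S_n+1$. $\mathcal K_n$ is the set of all $g\in\mathbb{R}^{S_n+2}$ such that $\Delta g(x)\ge 0$ for all $x\in\{1,\dots,S_n\}$ satisfying $\Delta\hat p_n(x)\le v_n$. $g_0=(g_0(0),\dots,g_0(S+1))$ is a centered Gaussian vector with covariance entries $\mathbb{1}_{\{i=j\}}p_0(i)-p_0(i)p_0(j)$, $i,j=0,\dots,S+1$; $\mathcal K_0$ is the set of $g\in\mathbb{R}^{S+2}$ with $\Delta g(k)\ge0$ for all $k\in\{1,\dots,S\}$ except possibly at knots of $p_0$; $\hat g_0$ is the unique minimizer of $\sum_{k=0}^{S+1}(g(k)-g_0(k))^2$ over $\mathcal K_0$. "Conditionally on $X_1,\dots,X_n$,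 $\hat T_n$ converges in distribution to $\hat T_0$ in probability" means that $\sup_h|E[h(\hat T_n)\mid X_1,\dots,X_n]-E[h(\hat T_0)]|\to0$ in probability, the supremum over all $h$ with $\sup|h|\le1$ and Lipschitz constant $\le1$. *)

theory Defs
  imports "HOL-Probability.Probability"
begin

definition Delta :: "(nat \<Rightarrow> real) \<Rightarrow> nat \<Rightarrow> real" where
  "Delta f k = f (Suc k) - 2 * f k + f (k - 1)"

definition convex_pmf :: "nat pmf \<Rightarrow> bool" where
  "convex_pmf p \<longleftrightarrow> (\<forall>k\<ge>1. Delta (pmf p) k \<ge> 0)"

definition knot :: "(nat \<Rightarrow> real) \<Rightarrow> nat \<Rightarrow> bool" where
  "knot p k \<longleftrightarrow> k \<ge> 1 \<and> Delta p k > 0"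

definition emp_pmf :: "nat list \<Rightarrow> nat \<Rightarrow> real" where
  "emp_pmf xs j = real (count_list xs j) / real (length xs)"

definition sample_max :: "nat list \<Rightarrow> nat" where
  "sample_max xs = Max (set xs)"

definition sample :: "(nat \<Rightarrow> 'a \<Rightarrow> nat) \<Rightarrow> nat \<Rightarrow> 'a \<Rightarrow> nat list" where
  "sample X n \<omega> = map (\<lambda>i. X i \<omega>) [1..<Suc n]"

definition conv_lse :: "nat list \<Rightarrow> nat pmf" where
  "conv_lse xs = (THE p. convex_pmf p \<and>
     (\<forall>q. convex_pmf q \<longrightarrow>
        (\<Sum>j. (emp_pmf xs j - pmf p j)\<^sup>2) \<le> (\<Sum>j. (emp_pmf xs j - pmf q j)\<^sup>2)))"

text \<open>Vectors in R^d are functions nat \<Rightarrow> real, using coordinates 0..d-1.\<close>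
definition sqdist :: "nat \<Rightarrow> (nat \<Rightarrow> real) \<Rightarrow> (nat \<Rightarrow> real) \<Rightarrow> real" where
  "sqdist d f g = (\<Sum>k<d. (f k - g k)\<^sup>2)"

definition is_proj :: "nat \<Rightarrow> (nat \<Rightarrow> real) set \<Rightarrow> (nat \<Rightarrow> real) \<Rightarrow> (nat \<Rightarrow> real) \<Rightarrow> bool" where
  "is_proj d K g f \<longleftrightarrow> f \<in> K \<and> (\<forall>f'\<in>K. sqdist d f g \<le> sqdist d f' g)"

definition proj :: "nat \<Rightarrow> (nat \<Rightarrow> real) set \<Rightarrow> (nat \<Rightarrow> real) \<Rightarrow> (nat \<Rightarrow> real)" where
  "proj d K g = (THE f. is_proj d K g f)"

definition Kn :: "nat list \<Rightarrow> real \<Rightarrow> (nat \<Rightarrow> real) set" where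
  "Kn xs v = {f \<in> extensional {..<sample_max xs + 2}.
     \<forall>x\<in>{1..sample_max xs}. Delta (pmf (conv_lse xs)) x \<le> v \<longrightarrow> Delta f x \<ge> 0}"

definition K0 :: "nat pmf \<Rightarrow> nat \<Rightarrow> (nat \<Rightarrow> real) set" where
  "K0 p S = {f \<in> extensional {..<S + 2}. \<forall>k\<in>{1..S}. \<not> knot (pmf p) k \<longrightarrow> Delta f k \<ge> 0}"

text \<open>Centered Gaussian vector in R^d with covariance C: law of A z, z standard normal, A A^T = C.\<close>
definition std_normal_vec :: "nat \<Rightarrow> (nat \<Rightarrow> real) measure" where
  "std_normal_vec d = PiM {..<d} (\<lambda>_. density lborel std_normal_density)"

definition gauss_vec :: "nat \<Rightarrow> (nat \<Rightarrow> nat \<Rightarrow> real) \<Rightarrow> (nat \<Rightarrow> real) measure" where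
  "gauss_vec d C = (let A = (SOME A. \<forall>i<d. \<forall>j<d. (\<Sum>k<d. A i k * A j k) = C i j) in
     distr (std_normal_vec d) (PiM {..<d} (\<lambda>_. (borel :: real measure)))
       (\<lambda>z. \<lambda>i\<in>{..<d}. \<Sum>k<d. A i k * z k))"

definition multinom_cov :: "(nat \<Rightarrow> real) \<Rightarrow> nat \<Rightarrow> nat \<Rightarrow> real" where
  "multinom_cov q i j = (if i = j then q i else 0) - q i * q j"

definition Tn :: "nat list \<Rightarrow> real \<Rightarrow> (nat \<Rightarrow> real) \<Rightarrow> real" where
  "Tn xs v g = sqdist (sample_max xs + 2) (proj (sample_max xs + 2) (Kn xs v) g) g"

definition T0 :: "nat pmf \<Rightarrow> nat \<Rightarrow> (nat \<Rightarrow> real) \<Rightarrow> real" where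
  "T0 p S g = sqdist (S + 2) (proj (S + 2) (K0 p S) g) g"

definition BL :: "(real \<Rightarrow> real) set" where
  "BL = {h. (\<forall>x. \<bar>h x\<bar> \<le> 1) \<and> (\<forall>x y. \<bar>h x - h y\<bar> \<le> \<bar>x - y\<bar>)}"

text \<open>sup_h |E[h(T_n) | X_1..X_n] - E[h(T_0)]|, for a given sample xs.\<close>
definition cond_BL_dist :: "nat list \<Rightarrow> real \<Rightarrow> nat pmf \<Rightarrow> nat \<Rightarrow> real" where
  "cond_BL_dist xs v p S = (SUP h\<in>BL.
     \<bar>(\<integral>g. h (Tn xs v g) \<partial>gauss_vec (sample_max xs + 2) (multinom_cov (emp_pmf xs)))
      - (\<integral>g. h (T0 p S g) \<partial>gauss_vec (S + 2) (multinom_cov (pmf p)))\<bar>)"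

text \<open>Convergence to 0 in (outer) probability.\<close>
definition tendsto_zero_in_prob :: "'a measure \<Rightarrow> (nat \<Rightarrow> 'a \<Rightarrow> real) \<Rightarrow> bool" where
  "tendsto_zero_in_prob M Y \<longleftrightarrow> (\<forall>\<epsilon>>0. \<forall>\<delta>>0. \<exists>N. \<forall>n\<ge>N. \<exists>A\<in>sets M.
     {\<omega>\<in>space M. \<epsilon> < Y n \<omega>} \<subseteq> A \<and> measure M A < \<delta>)"

end

theory Submission
  imports Defs
begin

text \<open>
  Let \<open>r\<close> be the largest deviation of the empirical pmf from \<open>p\<^sub>0\<close>; by Hoeffding's inequality \<open>r\<close> is of
  smaller order than \<open>v\<^sub>n\<close> with probability tending to one. Since \<open>p\<^sub>0\<close> competes with the least squares estimator,
  the second differences of the two differ by \<open>O(r)\<close>, so thresholding them at \<open>v\<^sub>n\<close> recovers exactly the knots of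
  \<open>p\<^sub>0\<close>: with high probability \<open>S\<^sub>n = S\<close> and the cone \<open>K\<^sub>n\<close> equals \<open>K\<^sub>0\<close>. On that event the two statistics are
  the same function of two Gaussian vectors. A Gaussian law depends only on its covariance, so both vectors can be
  realised as linear images of one standard normal vector \<open>z\<close>, using the square root
  \<open>diag (\<surd>q) - q (\<surd>q)\<^sup>T\<close> of \<open>diag q - q q\<^sup>T\<close>. It is continuous in \<open>q\<close>, and the squared distance to a
  cone is locally Lipschitz, which bounds the bounded Lipschitz distance by a multiple of \<open>\<surd>r\<close>.
\<close>

section \<open>Metric projections onto closed convex sets\<close>

text \<open>A near-parallelogram law forces near-minimizers together. \<open>D\<close> and
  \<open>Q\<close> are abstract so that the argument serves both projections in finite dimension and
  least squares over pmfs in l2. The limit \<open>L\<close> is not claimed to lie in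
  \<open>K\<close>, because convex pmfs can lose mass in the limit.\<close>

lemma minimizing_sequence:
  fixes D :: "('b \<Rightarrow> real) \<Rightarrow> real"
  assumes ne: "K \<noteq> {}" and nonneg: "\<And>f. f \<in> K \<Longrightarrow> 0 \<le> D f"
    and mid: "\<And>f g. f \<in> K \<Longrightarrow> g \<in> K \<Longrightarrow> \<exists>m\<in>K. D m \<le> (D f + D g) / 2 - Q f g / 4"
    and Q: "\<And>f g j. f \<in> K \<Longrightarrow> g \<in> K \<Longrightarrow> (f j - g j)\<^sup>2 \<le> Q f g"
  obtains F L where "\<And>m. F m \<in> K" "\<And>j. (\<lambda>m. F m j) \<longlonglongrightarrow> L j"
    "(\<lambda>m. D (F m)) \<longlonglongrightarrow> (INF f\<in>K. D f)" "\<And>f. f \<in> K \<Longrightarrow> (INF f\<in>K. D f) \<le> D f"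
proof -
  define I where "I = (INF f\<in>K. D f)"
  have bdd: "bdd_below (D ` K)" using nonneg by (intro bdd_belowI[of _ 0]) auto
  have I_le: "I \<le> D f" if "f \<in> K" for f
    unfolding I_def using bdd that by (rule cINF_lower)
  have "\<exists>f\<in>K. D f < I + 1 / real (Suc m)" for m
    using cINF_less_iff[OF ne bdd, of "I + 1 / real (Suc m)"] by (auto simp: I_def)
  then obtain F where F: "\<And>m. F m \<in> K" "\<And>m. D (F m) < I + 1 / real (Suc m)" by metis
  have lim: "(\<lambda>m. D (F m)) \<longlonglongrightarrow> I"
  proof (rule tendsto_sandwich)
    show "\<forall>\<^sub>F m in sequentially. I \<le> D (F m)" using F I_le by auto
    show "\<forall>\<^sub>F m in sequentially. D (F m) \<le> I + 1 / real (Suc m)" using F(2) by (intro always_eventually allI less_imp_le)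
    show "(\<lambda>m. I + 1 / real (Suc m)) \<longlonglongrightarrow> I"
      using tendsto_add[OF tendsto_const[of I] LIMSEQ_inverse_real_of_nat]
      by (simp add: inverse_eq_divide)
  qed simp
  \<comment> \<open>The midpoint of \<open>F m\<close> and \<open>F k\<close> cannot fall below the
    infimum, so a quarter of \<open>Q\<close> is at most the average of the two excesses.\<close>
  have close: "(F m j - F k j)\<^sup>2 \<le> 2 * (1 / real (Suc m)) + 2 * (1 / real (Suc k))" for m k j
  proof -
    obtain f where f: "f \<in> K" "D f \<le> (D (F m) + D (F k)) / 2 - Q (F m) (F k) / 4"
      using mid F by blast
    with I_le[OF f(1)] F(2)[of m] F(2)[of k] Q[OF F(1) F(1), of m j k] show ?thesis by argo
  qed
  have "convergent (\<lambda>m. F m j)" for j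
  proof (subst Cauchy_convergent_iff[symmetric], rule metric_CauchyI)
    fix e :: real assume e: "0 < e"
    obtain N where N: "1 / real (Suc N) < e\<^sup>2 / 4"
      using e nat_approx_posE[of "e\<^sup>2 / 4"] by auto
    have small: "1 / real (Suc m) < e\<^sup>2 / 4" if "m \<ge> N" for m
      using that by (intro le_less_trans[OF _ N] divide_left_mono) auto
    have "dist (F m j) (F k j) < e" if "m \<ge> N" "k \<ge> N" for m k
    proof -
      have "(F m j - F k j)\<^sup>2 < e\<^sup>2"
        using close[of m j k] small[OF that(1)] small[OF that(2)] by argo
      then show ?thesis
        using power2_less_imp_less[of "\<bar>F m j - F k j\<bar>" e] e by (simp add: dist_real_def)
    qed
    then show "\<exists>N. \<forall>m\<ge>N. \<forall>n\<ge>N. dist (F m j) (F n j) < e" by blast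
  qed
  then obtain L where "\<And>j. (\<lambda>m. F m j) \<longlonglongrightarrow> L j" unfolding convergent_def by metis
  with that F(1) lim I_le show thesis unfolding I_def by blast
qed

section \<open>Squared distance on the first \<open>d\<close> coordinates, and nearest
  points\<close>

lemma sqdist_eq_L2_set: "sqrt (sqdist d f g) = L2_set (\<lambda>k. f k - g k) {..<d}"
  by (simp add: sqdist_def L2_set_def)

lemma sqdist_nonneg [simp]: "0 \<le> sqdist d f g"
  by (simp add: sqdist_def sum_nonneg)

lemma sqdist_commute: "sqdist d f g = sqdist d g f"
  by (simp add: sqdist_def power2_commute)

lemma sqrt_sqdist_triangle: "sqrt (sqdist d f h) \<le> sqrt (sqdist d f g) + sqrt (sqdist d g h)"
  using L2_set_triangle_ineq[of "\<lambda>k. f k - g k" "\<lambda>k. g k - h k" "{..<d}"]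
  by (simp add: sqdist_eq_L2_set)

lemma coord_le_sqdist: "i < d \<Longrightarrow> (f i - g i)\<^sup>2 \<le> sqdist d f g"
  unfolding sqdist_def by (rule member_le_sum) auto

lemma sqdist_cong:
  "(\<And>i. i < d \<Longrightarrow> f i = f' i) \<Longrightarrow> (\<And>i. i < d \<Longrightarrow> g i = g' i) \<Longrightarrow> sqdist d f g = sqdist d f' g'"
  by (simp add: sqdist_def)

text \<open>The parallelogram identity; the midpoint is restricted to coordinates below
  \<open>d\<close> so that it stays extensional.\<close>

lemma sqdist_midpoint:
  "sqdist d (\<lambda>i\<in>{..<d}. (f i + f' i) / 2) g = (sqdist d f g + sqdist d f' g) / 2 - sqdist d f f' / 4"
proof -
  have "((a + b) / 2 - c)\<^sup>2 = (a - c)\<^sup>2 / 2 + (b - c)\<^sup>2 / 2 - (a - b)\<^sup>2 / 4" for a b c :: real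
    by (simp add: power2_eq_square field_simps)
  then show ?thesis
    by (simp add: sqdist_def sum.distrib sum_subtractf sum_divide_distrib add_divide_distrib)
qed

text \<open>Midpoints and coordinatewise limits are enough for a unique nearest point. The zero
  vector makes the set nonempty and bounds the distance to it by the norm. Extensionality pins down
  the coordinates from \<open>d\<close> on, which \<open>sqdist\<close> does not see, so that
  uniqueness is an equality of functions.\<close>

locale closed_midconvex =
  fixes d :: nat and K :: "(nat \<Rightarrow> real) set"
  assumes extensionalD: "f \<in> K \<Longrightarrow> f \<in> extensional {..<d}"
    and zero_mem: "(\<lambda>i\<in>{..<d}. 0) \<in> K"
    and midpoint_mem: "f \<in> K \<Longrightarrow> f' \<in> K \<Longrightarrow> (\<lambda>i\<in>{..<d}. (f i + f' i) / 2) \<in> K"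
    and limit_mem: "(\<And>m. F m \<in> K) \<Longrightarrow> (\<And>i. i < d \<Longrightarrow> (\<lambda>m. F m i) \<longlonglongrightarrow> L i) \<Longrightarrow> restrict L {..<d} \<in> K"
begin

text \<open>Quadratic growth around the minimizer: the midpoint of \<open>f\<close> and
  \<open>f'\<close> is a competitor of \<open>f\<close>, and the parallelogram identity evaluates
  its distance.\<close>

lemma proj_gap:
  assumes "is_proj d K g f" "f' \<in> K"
  shows "sqdist d f f' \<le> 2 * (sqdist d f' g - sqdist d f g)"
proof -
  have "sqdist d f g \<le> sqdist d (\<lambda>i\<in>{..<d}. (f i + f' i) / 2) g"
    using assms midpoint_mem by (auto simp: is_proj_def)
  then show ?thesis unfolding sqdist_midpoint by argo
qed

lemma ex1_proj: "\<exists>!f. is_proj d K g f"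
proof (rule ex_ex1I)
  obtain F L where F: "\<And>m. F m \<in> K" and L: "\<And>j. (\<lambda>m. F m j) \<longlonglongrightarrow> L j"
    and I: "(\<lambda>m. sqdist d (F m) g) \<longlonglongrightarrow> (INF f\<in>K. sqdist d f g)"
    and le: "\<And>f. f \<in> K \<Longrightarrow> (INF f\<in>K. sqdist d f g) \<le> sqdist d f g"
  proof (rule minimizing_sequence[of K "\<lambda>f. sqdist d f g" "sqdist d"])
    show "(f j - f' j)\<^sup>2 \<le> sqdist d f f'" if "f \<in> K" "f' \<in> K" for f f' j
      using extensionalD[OF that(1)] extensionalD[OF that(2)] coord_le_sqdist[of j d f f']
      by (cases "j < d") (auto simp: extensional_def)
    show "\<exists>m\<in>K. sqdist d m g \<le> (sqdist d f g + sqdist d f' g) / 2 - sqdist d f f' / 4"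
      if "f \<in> K" "f' \<in> K" for f f'
      using midpoint_mem[OF that] sqdist_midpoint by (metis order_refl)
  qed (use zero_mem in auto)
  have "(\<lambda>m. sqdist d (F m) g) \<longlonglongrightarrow> sqdist d (restrict L {..<d}) g"
    unfolding sqdist_def using L by (auto intro!: tendsto_intros)
  then have "sqdist d (restrict L {..<d}) g = (INF f\<in>K. sqdist d f g)"
    using I LIMSEQ_unique by blast
  with limit_mem[OF F L] le show "\<exists>f. is_proj d K g f"
    unfolding is_proj_def by metis
next
  fix f f' assume p: "is_proj d K g f" "is_proj d K g f'"
  then have "sqdist d f f' \<le> 0"
    using proj_gap[OF p(1), of f'] by (auto simp: is_proj_def intro: antisym)
  then have eq: "f i = f' i" if "i < d" for i
    using coord_le_sqdist[OF that, of f f'] by (metis eq_iff_diff_eq_0 order_trans power2_less_eq_zero_iff)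
  show "f = f'"
    using eq p extensionalD by (intro extensionalityI[of _ "{..<d}"]) (auto simp: is_proj_def)
qed

lemma is_proj_proj: "is_proj d K g (proj d K g)"
  unfolding proj_def by (rule theI'[OF ex1_proj])

lemma proj_mem: "proj d K g \<in> K"
  using is_proj_proj by (simp add: is_proj_def)

lemma sqdist_proj_le: "f \<in> K \<Longrightarrow> sqdist d (proj d K g) g \<le> sqdist d f g"
  using is_proj_proj by (simp add: is_proj_def)

lemma sqrt_sqdist_proj_le: "sqrt (sqdist d (proj d K g) g) \<le> sqrt (sqdist d (proj d K g') g') + sqrt (sqdist d g' g)"
  using sqdist_proj_le[OF proj_mem, of g g'] sqrt_sqdist_triangle[of d "proj d K g'" g g']
  by (meson order_trans real_sqrt_le_iff)

text \<open>The distance to a set is 1-Lipschitz: the projection of one point competes for the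
  other.\<close>

lemma abs_sqrt_sqdist_proj_diff_le:
  "\<bar>sqrt (sqdist d (proj d K g) g) - sqrt (sqdist d (proj d K g') g')\<bar> \<le> sqrt (sqdist d g g')"
  using sqrt_sqdist_proj_le[of g g'] sqrt_sqdist_proj_le[of g' g] by (simp add: sqdist_commute[of d g' g] abs_le_iff)

lemma sqrt_sqdist_proj_le_norm: "sqrt (sqdist d (proj d K g) g) \<le> sqrt (sqdist d g (\<lambda>_. 0))"
proof -
  have "sqdist d (\<lambda>i\<in>{..<d}. 0) g = sqdist d g (\<lambda>_. 0)"
    by (subst sqdist_commute) (rule sqdist_cong, auto)
  with sqdist_proj_le[OF zero_mem, of g] show ?thesis by simp
qed

text \<open>The squared distance is only locally Lipschitz. Factoring a difference of squares leaves
  the 1-Lipschitz distance times a sum that is controlled by the norms.\<close>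

lemma abs_sqdist_proj_diff_le:
  "\<bar>sqdist d (proj d K g) g - sqdist d (proj d K g') g'\<bar>
    \<le> sqrt (sqdist d g g') * (sqrt (sqdist d g (\<lambda>_. 0)) + sqrt (sqdist d g' (\<lambda>_. 0)))"
proof -
  define a b where "a = sqrt (sqdist d (proj d K g) g)" and "b = sqrt (sqdist d (proj d K g') g')"
  have "sqdist d (proj d K g) g - sqdist d (proj d K g') g' = (a - b) * (a + b)"
    by (simp add: a_def b_def algebra_simps)
  moreover have "\<bar>(a - b) * (a + b)\<bar> = \<bar>a - b\<bar> * (a + b)"
    by (simp add: abs_mult a_def b_def)
  moreover have "\<dots> \<le> sqrt (sqdist d g g') * (sqrt (sqdist d g (\<lambda>_. 0)) + sqrt (sqdist d g' (\<lambda>_. 0)))"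
    unfolding a_def b_def
    by (intro mult_mono add_mono abs_sqrt_sqdist_proj_diff_le sqrt_sqdist_proj_le_norm) auto
  ultimately show ?thesis by simp
qed

text \<open>Apply \<open>proj_gap\<close> at \<open>g\<close> with the projection of
  \<open>g'\<close> as competitor. The bound is weaker than nonexpansiveness but tends to 0 as
  \<open>g'\<close> approaches \<open>g\<close>, which yields continuity.\<close>

lemma sqdist_proj_proj_le:
  "sqdist d (proj d K g) (proj d K g')
    \<le> 2 * ((sqrt (sqdist d (proj d K g) g) + 2 * sqrt (sqdist d g' g))\<^sup>2 - sqdist d (proj d K g) g)"
proof -
  have "sqrt (sqdist d (proj d K g') g) \<le> sqrt (sqdist d (proj d K g) g) + 2 * sqrt (sqdist d g' g)"
    using sqrt_sqdist_triangle[of d "proj d K g'" g g'] sqrt_sqdist_proj_le[of g' g]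
      sqdist_commute[of d g g'] by simp
  from power_mono[OF this, of 2]
  have "sqdist d (proj d K g') g \<le> (sqrt (sqdist d (proj d K g) g) + 2 * sqrt (sqdist d g' g))\<^sup>2"
    by simp
  with proj_gap[OF is_proj_proj proj_mem, of g g'] show ?thesis by argo
qed

lemma continuous_proj: "continuous_on UNIV (\<lambda>g. proj d K g i)"
proof (cases "i < d")
  case True
  show ?thesis unfolding continuous_on_def
  proof
    fix g :: "nat \<Rightarrow> real"
    have coord: "((\<lambda>g. g k) \<longlongrightarrow> g k) (at g)" for k
      using continuous_on_product_coordinates[of k] by (auto simp: continuous_on_def)
    let ?u = "\<lambda>g'. 2 * ((sqrt (sqdist d (proj d K g) g) + 2 * sqrt (sqdist d g' g))\<^sup>2 - sqdist d (proj d K g) g)"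
    have "((\<lambda>g'. sqdist d g' g) \<longlongrightarrow> sqdist d g g) (at g)"
      unfolding sqdist_def by (intro tendsto_intros coord)
    then have "((\<lambda>g'. sqdist d g' g) \<longlongrightarrow> 0) (at g)" by (simp add: sqdist_def)
    then have "(?u \<longlongrightarrow> 2 * ((sqrt (sqdist d (proj d K g) g) + 2 * sqrt 0)\<^sup>2 - sqdist d (proj d K g) g)) (at g)"
      by (intro tendsto_intros)
    then have u: "(?u \<longlongrightarrow> 0) (at g)" by simp
    have "((\<lambda>g'. (proj d K g i - proj d K g' i)\<^sup>2) \<longlongrightarrow> 0) (at g)"
      by (rule tendsto_sandwich[OF _ _ tendsto_const u])
        (intro always_eventually allI zero_le_power2
          order_trans[OF coord_le_sqdist[OF True] sqdist_proj_proj_le])+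
    then have "((\<lambda>g'. sqrt ((proj d K g i - proj d K g' i)\<^sup>2)) \<longlongrightarrow> sqrt 0) (at g)"
      by (rule tendsto_real_sqrt)
    then have "((\<lambda>g'. proj d K g i - proj d K g' i) \<longlongrightarrow> 0) (at g)"
      by (simp add: tendsto_rabs_zero_iff)
    from tendsto_diff[OF tendsto_const[of "proj d K g i"] this]
    show "((\<lambda>g. proj d K g i) \<longlongrightarrow> proj d K g i) (at g within UNIV)" by simp
  qed
next
  case False
  \<comment> \<open>Outside the first \<open>d\<close> coordinates every element of \<open>K\<close>
    takes the value \<open>undefined\<close>, so this coordinate of the projection is
    constant.\<close>
  then have "(\<lambda>g. proj d K g i) = (\<lambda>_. undefined)"
    using extensionalD[OF proj_mem] by (auto simp: extensional_def)
  then show ?thesis by (simp only: continuous_on_const)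
qed

text \<open>Over the countable index set of all naturals the product sigma-algebra is the Borel one,
  so continuity of each coordinate gives measurability.\<close>

lemma measurable_proj [measurable]:
  "proj d K \<in> measurable (PiM UNIV (\<lambda>_. borel)) (PiM UNIV (\<lambda>_. borel))"
proof (rule measurable_PiM_single')
  fix i :: nat
  have "(\<lambda>g. proj d K g i) \<in> borel_measurable borel"
    by (rule borel_measurable_continuous_onI[OF continuous_proj])
  then show "(\<lambda>g. proj d K g i) \<in> borel_measurable (PiM UNIV (\<lambda>_. borel))"
    by (simp cong: measurable_cong_sets add: sets_PiM_equal_borel)
qed auto

lemma measurable_sqdist_proj [measurable]:
  "(\<lambda>g. sqdist d (proj d K g) g) \<in> borel_measurable (PiM UNIV (\<lambda>_. borel))"
  unfolding sqdist_def
  using measurable_compose[OF measurable_proj measurable_component_singleton]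
  by (intro borel_measurable_sum borel_measurable_power borel_measurable_diff) auto

lemma proj_cong: "(\<And>i. i < d \<Longrightarrow> g i = g' i) \<Longrightarrow> proj d K g = proj d K g'"
  by (simp add: proj_def is_proj_def sqdist_def)

text \<open>The laws \<open>gauss_vec\<close> live on the product over \<open>{..<d}\<close>.
  Padding with zeros carries the previous lemma over to that space.\<close>

lemma measurable_sqdist_proj_finite [measurable]:
  "(\<lambda>g. sqdist d (proj d K g) g) \<in> borel_measurable (PiM {..<d} (\<lambda>_. borel))"
proof -
  have "(\<lambda>g i. if i < d then g i else 0 :: real) \<in> measurable (PiM {..<d} (\<lambda>_. borel)) (PiM UNIV (\<lambda>_. borel))"
  proof (rule measurable_PiM_single')
    fix i
    show "(\<lambda>g. if i < d then g i else 0) \<in> borel_measurable (PiM {..<d} (\<lambda>_. borel :: real measure))"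
      by (cases "i < d") auto
  qed auto
  from measurable_compose[OF this measurable_sqdist_proj]
  have "(\<lambda>g. sqdist d (proj d K (\<lambda>i. if i < d then g i else 0)) (\<lambda>i. if i < d then g i else 0))
      \<in> borel_measurable (PiM {..<d} (\<lambda>_. borel))" .
  moreover have "proj d K (\<lambda>i. if i < d then g i else 0) = proj d K g" for g
    by (rule proj_cong) auto
  ultimately show ?thesis by (simp add: sqdist_def)
qed

end

text \<open>Both cones have this shape and differ only in \<open>P\<close>. Indices in
  \<open>{1..s}\<close> keep \<open>x - 1\<close>, \<open>x\<close> and \<open>x + 1\<close> inside
  the \<open>s + 2\<close> coordinates, so restriction does not disturb
  \<open>Delta\<close>.\<close>

lemma closed_midconvex_Delta_nonneg:
  assumes "\<And>x. P x \<Longrightarrow> x \<in> {1..s}"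
  shows "closed_midconvex (s + 2) {f \<in> extensional {..<s + 2}. \<forall>x. P x \<longrightarrow> 0 \<le> Delta f x}"
proof
  fix F :: "nat \<Rightarrow> nat \<Rightarrow> real" and L
  assume F: "\<And>m. F m \<in> {f \<in> extensional {..<s + 2}. \<forall>x. P x \<longrightarrow> 0 \<le> Delta f x}"
    and L: "\<And>i. i < s + 2 \<Longrightarrow> (\<lambda>m. F m i) \<longlonglongrightarrow> L i"
  have "0 \<le> Delta L x" if "P x" for x
  proof (rule tendsto_lowerbound)
    show "(\<lambda>m. Delta (F m) x) \<longlonglongrightarrow> Delta L x"
      unfolding Delta_def using assms[OF that] by (intro tendsto_intros L) auto
  qed (use F that in auto)
  moreover have "Delta (restrict L {..<s + 2}) x = Delta L x" if "P x" for x
    using assms[OF that] by (auto simp: Delta_def)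
  ultimately show "restrict L {..<s + 2} \<in> {f \<in> extensional {..<s + 2}. \<forall>x. P x \<longrightarrow> 0 \<le> Delta f x}"
    by auto
next
  fix f f' :: "nat \<Rightarrow> real"
  assume f: "f \<in> {f \<in> extensional {..<s + 2}. \<forall>x. P x \<longrightarrow> 0 \<le> Delta f x}"
      "f' \<in> {f \<in> extensional {..<s + 2}. \<forall>x. P x \<longrightarrow> 0 \<le> Delta f x}"
  have "Delta (\<lambda>i\<in>{..<s + 2}. (f i + f' i) / 2) x = (Delta f x + Delta f' x) / 2" if "P x" for x
    using assms[OF that] by (auto simp: Delta_def field_simps)
  moreover have "0 \<le> (Delta f x + Delta f' x) / 2" if "P x" for x
    using f that by auto
  ultimately have "0 \<le> Delta (\<lambda>i\<in>{..<s + 2}. (f i + f' i) / 2) x" if "P x" for x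
    using that by presburger
  with f show "(\<lambda>i\<in>{..<s + 2}. (f i + f' i) / 2) \<in> {f \<in> extensional {..<s + 2}. \<forall>x. P x \<longrightarrow> 0 \<le> Delta f x}"
    by auto
qed (use assms in \<open>auto simp: Delta_def\<close>, force+)

lemma closed_midconvex_Kn: "closed_midconvex (sample_max xs + 2) (Kn xs v)"
proof -
  have "Kn xs v = {f \<in> extensional {..<sample_max xs + 2}. \<forall>x.
      x \<in> {1..sample_max xs} \<and> Delta (pmf (conv_lse xs)) x \<le> v \<longrightarrow> 0 \<le> Delta f x}"
    unfolding Kn_def by auto
  then show ?thesis by (simp only:) (rule closed_midconvex_Delta_nonneg, simp)
qed

lemma closed_midconvex_K0: "closed_midconvex (S + 2) (K0 p S)"
proof -
  have "K0 p S = {f \<in> extensional {..<S + 2}. \<forall>x.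
      x \<in> {1..S} \<and> \<not> knot (pmf p) x \<longrightarrow> 0 \<le> Delta f x}"
    unfolding K0_def by auto
  then show ?thesis by (simp only:) (rule closed_midconvex_Delta_nonneg, simp)
qed

section \<open>The convex least squares estimator\<close>

lemma pmf_nat_sums: "pmf (p :: nat pmf) sums 1"
proof -
  have "pmf p sums infsetsum (pmf p) UNIV"
    by (rule sums_infsetsum_nat'[OF pmf_abs_summable])
  then show ?thesis by (simp add: infsetsum_pmf_eq_1)
qed

lemma ex_pmf_nat:
  assumes "\<And>i :: nat. 0 \<le> f i" "f sums 1"
  shows "\<exists>p. pmf p = f"
proof -
  have "(\<integral>\<^sup>+ i. ennreal (f i) \<partial>count_space UNIV) = (\<Sum>i. ennreal (f i))"
    by (rule nn_integral_count_space_nat)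
  also have "\<dots> = ennreal (\<Sum>i. f i)"
    using assms by (intro suminf_ennreal2) (auto simp: sums_iff)
  finally have "pmf (embed_pmf f) x = f x" for x
    using assms by (intro pmf_embed_pmf) (auto simp: sums_iff)
  then show ?thesis by blast
qed

lemma summable_sq_diff:
  fixes a b :: "nat \<Rightarrow> real"
  assumes "summable (\<lambda>j. (a j)\<^sup>2)" "summable (\<lambda>j. (b j)\<^sup>2)"
  shows "summable (\<lambda>j. (a j - b j)\<^sup>2)"
proof (rule summable_comparison_test')
  show "summable (\<lambda>j. 2 * (a j)\<^sup>2 + 2 * (b j)\<^sup>2)" using assms by (intro summable_add summable_mult)
  show "norm ((a j - b j)\<^sup>2) \<le> 2 * (a j)\<^sup>2 + 2 * (b j)\<^sup>2" for j
  proof -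
    have "(a j - b j)\<^sup>2 + (a j + b j)\<^sup>2 = 2 * (a j)\<^sup>2 + 2 * (b j)\<^sup>2"
      by (simp add: power2_eq_square algebra_simps)
    then show ?thesis using zero_le_power2[of "a j + b j"] unfolding real_norm_def abs_power2 by linarith
  qed
qed

lemma summable_sq_le_one:
  fixes f :: "nat \<Rightarrow> real"
  assumes "summable f" "\<And>j. 0 \<le> f j" "\<And>j. f j \<le> 1"
  shows "summable (\<lambda>j. (f j)\<^sup>2)"
proof (rule summable_comparison_test')
  show "norm ((f j)\<^sup>2) \<le> f j" for j
    using assms(2,3)[of j] by (simp add: power2_eq_square mult_left_le)
qed (fact assms(1))

lemma summable_pmf_sq: "summable (\<lambda>j. (pmf (p :: nat pmf) j)\<^sup>2)"
  using pmf_nat_sums[of p] by (intro summable_sq_le_one) (auto simp: sums_iff pmf_le_1)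

text \<open>Subtraction of naturals truncates at 0, so this is a convex triangle supported below
  \<open>j\<close>; suitably scaled, it carries the mass that is put back below.\<close>

lemma Delta_truncated_nonneg: "1 \<le> k \<Longrightarrow> 0 \<le> Delta (\<lambda>i. real (j - i)) k"
  by (cases "k < j") (auto simp: Delta_def of_nat_diff)

lemma Delta_add_mult: "Delta (\<lambda>i. f i + c * g i) k = Delta f k + c * Delta g k"
  by (simp add: Delta_def algebra_simps)

lemma sum_truncated: "(\<Sum>i<j. real (j - i)) = real j * (real j + 1) / 2"
proof -
  have "(\<Sum>i<j. real (j - i)) = (\<Sum>i<j. real (Suc i))"
    by (rule sum.reindex_bij_witness[of _ "\<lambda>i. j - Suc i" "\<lambda>i. j - Suc i"]) (auto simp: of_nat_diff)
  also have "\<dots> = real j * (real j + 1) / 2" by (induction j) (auto simp: field_simps)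
  finally show ?thesis .
qed

lemma convex_pmf_midpoint:
  fixes a :: "nat \<Rightarrow> real"
  assumes "convex_pmf p" "convex_pmf q" and a: "summable (\<lambda>j. (a j)\<^sup>2)"
  shows "\<exists>r. convex_pmf r \<and> (\<Sum>j. (a j - pmf r j)\<^sup>2) =
    ((\<Sum>j. (a j - pmf p j)\<^sup>2) + (\<Sum>j. (a j - pmf q j)\<^sup>2)) / 2 - (\<Sum>j. (pmf p j - pmf q j)\<^sup>2) / 4"
proof -
  have "(\<lambda>j. (pmf p j + pmf q j) / 2) sums ((1 + 1) / 2)"
    by (intro sums_divide sums_add pmf_nat_sums)
  then obtain r where r: "pmf r = (\<lambda>j. (pmf p j + pmf q j) / 2)"
    using ex_pmf_nat[of "\<lambda>j. (pmf p j + pmf q j) / 2"] by auto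
  have "Delta (pmf r) k = (Delta (pmf p) k + Delta (pmf q) k) / 2" for k
    by (simp add: r Delta_def field_simps)
  moreover have "0 \<le> (Delta (pmf p) k + Delta (pmf q) k) / 2" if "1 \<le> k" for k
    using assms that by (simp add: convex_pmf_def)
  ultimately have "convex_pmf r" by (metis convex_pmf_def)
  have eq: "(a j - pmf r j)\<^sup>2 = ((a j - pmf p j)\<^sup>2 + (a j - pmf q j)\<^sup>2) / 2 - (pmf p j - pmf q j)\<^sup>2 / 4" for j
    by (simp add: r power2_eq_square field_simps)
  have "(\<lambda>j. (a j - pmf r j)\<^sup>2) sums
    (((\<Sum>j. (a j - pmf p j)\<^sup>2) + (\<Sum>j. (a j - pmf q j)\<^sup>2)) / 2 - (\<Sum>j. (pmf p j - pmf q j)\<^sup>2) / 4)"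
    unfolding eq
    by (intro sums_diff sums_divide sums_add summable_sums summable_sq_diff a summable_pmf_sq)
  with \<open>convex_pmf r\<close> show ?thesis by (auto simp: sums_iff)
qed

text \<open>Convex pmfs are not closed in \<open>\<ell>\<^sup>2\<close>: mass can escape to infinity. This cannot happen along a minimizing
  sequence, since putting the missing mass back as a wide triangle strictly decreases the distance.\<close>
lemma convex_deficient_not_optimal:
  fixes a L :: "nat \<Rightarrow> real"
  assumes a: "\<And>j. 0 \<le> a j" "\<And>j. m < j \<Longrightarrow> a j = 0" "(\<Sum>j\<le>m. a j) = 1"
    and L: "\<And>j. 0 \<le> L j" "\<And>k. 1 \<le> k \<Longrightarrow> 0 \<le> Delta L k" "L sums c" "c < 1"
  shows "\<exists>q. convex_pmf q \<and> (\<Sum>j. (a j - pmf q j)\<^sup>2) < (\<Sum>j. (a j - L j)\<^sup>2)"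
proof -
  \<comment> \<open>The base of the triangle must be wide compared with \<open>m\<close> and the
    missing mass: the choice means \<open>2 * m / j < 1 - c\<close>.\<close>
  obtain j :: nat where j: "2 * real m / (1 - c) < real j" using reals_Archimedean2 by blast
  have "0 \<le> 2 * real m / (1 - c)" using L(4) by simp
  then have j0: "0 < real j" using j by linarith
  \<comment> \<open>\<open>w\<close> is the height at 0 that gives the triangle \<open>t\<close> of
    base \<open>j\<close> total mass one.\<close>
  define w where "w = 2 / (real j + 1)"
  define t where "t = (\<lambda>i. w / real j * real (j - i))"
  have w0: "0 < w" by (simp add: w_def)
  have t0: "0 \<le> t i" for i using j0 w0 by (simp add: t_def)
  have tw: "t i \<le> w" for i
  proof -
    have "real (j - i) \<le> real j" by simp
    then have "w / real j * real (j - i) \<le> w / real j * real j"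
      using j0 w0 by (intro mult_left_mono) auto
    then show ?thesis using j0 by (simp add: t_def)
  qed
  \<comment> \<open>On the support of \<open>a\<close> the wide triangle is still close to its
    peak.\<close>
  have ta: "w * (1 - real m / real j) * a i \<le> a i * t i" for i
  proof (cases "i \<le> m")
    case True
    then have "real j - real m \<le> real (j - i)" by linarith
    then have "w / real j * (real j - real m) \<le> w / real j * real (j - i)"
      using j0 w0 by (intro mult_left_mono) auto
    moreover have "w / real j * (real j - real m) = w * (1 - real m / real j)"
      using j0 by (simp add: field_simps)
    ultimately have "w * (1 - real m / real j) \<le> t i" by (simp add: t_def)
    then show ?thesis using a(1)[of i] by (metis mult.commute mult_left_mono)
  qed (use a(2) in auto)
  have "t sums (\<Sum>i<j. t i)" by (rule sums_finite) (auto simp: t_def)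
  also have "(\<Sum>i<j. t i) = 1"
    unfolding t_def sum_distrib_left[symmetric] sum_truncated w_def using j0 by simp
  finally have t1: "t sums 1" .
  have "(\<lambda>i. L i + (1 - c) * t i) sums (c + (1 - c) * 1)"
    by (intro sums_add sums_mult L t1)
  then obtain q where q: "pmf q = (\<lambda>i. L i + (1 - c) * t i)"
    using ex_pmf_nat[of "\<lambda>i. L i + (1 - c) * t i"] L t0 by auto
  have "convex_pmf q"
    unfolding convex_pmf_def
  proof (intro allI impI)
    fix k :: nat assume "1 \<le> k"
    have "Delta t k = w / real j * Delta (\<lambda>i. real (j - i)) k"
      by (simp add: t_def Delta_def algebra_simps)
    then have "0 \<le> Delta t k" using Delta_truncated_nonneg[OF \<open>1 \<le> k\<close>, of j] w0 j0 by simp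
    then show "0 \<le> Delta (pmf q) k"
      using L(2)[OF \<open>1 \<le> k\<close>] L(4) by (simp add: q Delta_add_mult)
  qed
  have sa: "a sums 1"
    using sums_finite[of "{..m}" a] a by auto
  have a2: "summable (\<lambda>j. (a j)\<^sup>2)"
    by (rule summable_finite[of "{..m}"]) (use a in auto)
  have "L i \<le> 1" for i
    using sum_le_suminf[of L "{i}"] L by (auto simp: sums_iff)
  then have L2: "summable (\<lambda>j. (L j)\<^sup>2)"
    using L by (intro summable_sq_le_one) (auto simp: sums_iff)
  \<comment> \<open>Expand the square for \<open>q = L + (1 - c) t\<close>. The cross term with
    \<open>L\<close> uses \<open>t <= w\<close>, the one with \<open>a\<close> uses
    \<open>ta\<close>, and \<open>t * t <= w * t\<close>; every remaining term has an explicit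
    sum.\<close>
  have le: "(a i - pmf q i)\<^sup>2 \<le> (a i - L i)\<^sup>2
      + (2 * (1 - c) * (w * L i - w * (1 - real m / real j) * a i) + (1 - c)\<^sup>2 * (w * t i))" for i
  proof -
    have "(a i - pmf q i)\<^sup>2 = (a i - L i)\<^sup>2 + (2 * (1 - c) * (t i * L i - a i * t i) + (1 - c)\<^sup>2 * (t i * t i))"
      by (simp add: q power2_eq_square algebra_simps)
    also have "\<dots> \<le> (a i - L i)\<^sup>2
      + (2 * (1 - c) * (w * L i - w * (1 - real m / real j) * a i) + (1 - c)\<^sup>2 * (w * t i))"
      using L(4) L(1) t0 tw ta by (intro add_mono mult_left_mono diff_mono mult_right_mono order_refl) auto
    finally show ?thesis .
  qed
  have "(\<Sum>i. (a i - pmf q i)\<^sup>2) \<le> (\<Sum>i. (a i - L i)\<^sup>2)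
      + (2 * (1 - c) * (w * c - w * (1 - real m / real j) * 1) + (1 - c)\<^sup>2 * (w * 1))"
  proof (rule sums_le[OF le])
    show "(\<lambda>i. (a i - pmf q i)\<^sup>2) sums (\<Sum>i. (a i - pmf q i)\<^sup>2)"
      by (intro summable_sums summable_sq_diff a2 summable_pmf_sq)
  qed (intro sums_add sums_diff sums_mult summable_sums summable_sq_diff a2 L2 L t1 sa)
  \<comment> \<open>The net change has the sign of \<open>2 * m / j - (1 - c)\<close>, negative by
    the choice of \<open>j\<close>.\<close>
  also have "\<dots> = (\<Sum>i. (a i - L i)\<^sup>2) + w * (1 - c) * (2 * (real m / real j) - (1 - c))"
  proof -
    have "y + (2 * (1 - c) * (w * c - w * (1 - x) * 1) + (1 - c)\<^sup>2 * (w * 1)) = y + w * (1 - c) * (2 * x - (1 - c))"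
      for x y by (simp add: power2_eq_square algebra_simps)
    then show ?thesis .
  qed
  also have "\<dots> < (\<Sum>i. (a i - L i)\<^sup>2)"
  proof -
    have "2 * (real m / real j) < 1 - c"
      using j j0 L(4) by (simp add: field_simps)
    then show ?thesis using w0 L(4) by (simp add: mult_pos_neg)
  qed
  finally show ?thesis using \<open>convex_pmf q\<close> by blast
qed

text \<open>A minimizing sequence has a coordinatewise limit that is nonnegative, convex and of mass
  at most one. Mass below one would contradict minimality by the preceding lemma, so the limit is a
  pmf. The midpoint of two distinct minimizers would be strictly better than both.\<close>

lemma convex_lse_ex1:
  fixes a :: "nat \<Rightarrow> real"
  assumes a: "\<And>j. 0 \<le> a j" "\<And>j. m < j \<Longrightarrow> a j = 0" "(\<Sum>j\<le>m. a j) = 1"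
  shows "\<exists>!p. convex_pmf p \<and>
    (\<forall>q. convex_pmf q \<longrightarrow> (\<Sum>j. (a j - pmf p j)\<^sup>2) \<le> (\<Sum>j. (a j - pmf q j)\<^sup>2))"
proof (rule ex_ex1I)
  let ?D = "\<lambda>f. \<Sum>j. (a j - f j)\<^sup>2" and ?Q = "\<lambda>f g. \<Sum>j. (f j - g j :: real)\<^sup>2"
  let ?K = "pmf ` {p. convex_pmf p}"
  have a2: "summable (\<lambda>j. (a j)\<^sup>2)"
    by (rule summable_finite[of "{..m}"]) (use a in auto)
  have sq_le: "(pmf p j - pmf q j)\<^sup>2 \<le> ?Q (pmf p) (pmf q)" for p q j
    using sum_le_suminf[OF summable_sq_diff[OF summable_pmf_sq summable_pmf_sq], of "{j}" p q] by simp
  obtain F L where F: "\<And>n. F n \<in> ?K" and L: "\<And>j. (\<lambda>n. F n j) \<longlonglongrightarrow> L j"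
    and I: "(\<lambda>n. ?D (F n)) \<longlonglongrightarrow> (INF f\<in>?K. ?D f)"
    and I_le: "\<And>f. f \<in> ?K \<Longrightarrow> (INF f\<in>?K. ?D f) \<le> ?D f"
  proof (rule minimizing_sequence[of ?K ?D ?Q])
    have "convex_pmf (return_pmf 0)" by (auto simp: convex_pmf_def Delta_def)
    then show "?K \<noteq> {}" by blast
    show "0 \<le> ?D f" if "f \<in> ?K" for f
      using that by (auto intro!: suminf_nonneg summable_sq_diff a2 summable_pmf_sq)
    show "\<exists>r\<in>?K. ?D r \<le> (?D f + ?D g) / 2 - ?Q f g / 4" if "f \<in> ?K" "g \<in> ?K" for f g
    proof -
      from that obtain p q where pq: "f = pmf p" "convex_pmf p" "g = pmf q" "convex_pmf q" by auto
      obtain r where "convex_pmf r" "?D (pmf r) = (?D f + ?D g) / 2 - ?Q f g / 4"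
        using convex_pmf_midpoint[OF pq(2) pq(4) a2] unfolding pq by blast
      then show ?thesis by (intro bexI[of _ "pmf r"]) simp_all
    qed
    show "(f j - g j)\<^sup>2 \<le> ?Q f g" if "f \<in> ?K" "g \<in> ?K" for f g j
      using that sq_le by blast
  qed blast
  from F obtain P where P: "\<And>n. F n = pmf (P n)" "\<And>n. convex_pmf (P n)"
    unfolding image_iff mem_Collect_eq Bex_def by metis
  have L0: "0 \<le> L j" for j
    by (rule tendsto_lowerbound[OF L]) (auto simp: P)
  have LD: "0 \<le> Delta L k" if "1 \<le> k" for k
  proof (rule tendsto_lowerbound)
    show "(\<lambda>n. Delta (F n) k) \<longlonglongrightarrow> Delta L k"
      unfolding Delta_def by (intro tendsto_intros L)
  qed (use P that in \<open>auto simp: convex_pmf_def\<close>)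
  have L1: "(\<Sum>j<N. L j) \<le> 1" for N
  proof (rule tendsto_upperbound)
    show "(\<lambda>n. \<Sum>j<N. F n j) \<longlonglongrightarrow> (\<Sum>j<N. L j)" by (intro tendsto_intros L)
    show "\<forall>\<^sub>F n in sequentially. (\<Sum>j<N. F n j) \<le> 1"
    proof (intro always_eventually allI)
      show "(\<Sum>j<N. F n j) \<le> 1" for n
        using sum_le_suminf[of "pmf (P n)" "{..<N}"] pmf_nat_sums[of "P n"] by (simp add: P sums_iff)
    qed
  qed simp
  have sL: "summable L"
    by (rule summableI_nonneg_bounded[OF L0 L1])
  have "L j \<le> 1" for j
    using L1[of "Suc j"] sum_nonneg[of "{..<j}" L] L0 by simp
  then have L2: "summable (\<lambda>j. (L j)\<^sup>2)"
    using sL L0 by (intro summable_sq_le_one)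
  \<comment> \<open>Lower semicontinuity: partial sums pass to the limit, and along the sequence
    they are bounded by the full sums.\<close>
  have DL: "?D L \<le> (INF f\<in>?K. ?D f)"
  proof (rule suminf_le_const)
    show "summable (\<lambda>j. (a j - L j)\<^sup>2)" by (intro summable_sq_diff a2 L2)
    fix N
    show "(\<Sum>j<N. (a j - L j)\<^sup>2) \<le> (INF f\<in>?K. ?D f)"
    proof (rule tendsto_le[OF _ I])
      show "(\<lambda>n. \<Sum>j<N. (a j - F n j)\<^sup>2) \<longlonglongrightarrow> (\<Sum>j<N. (a j - L j)\<^sup>2)" by (intro tendsto_intros L)
      show "\<forall>\<^sub>F n in sequentially. (\<Sum>j<N. (a j - F n j)\<^sup>2) \<le> ?D (F n)"
        by (intro always_eventually allI sum_le_suminf) (auto simp: P intro!: summable_sq_diff a2 summable_pmf_sq)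
    qed simp
  qed
  have "suminf L = 1"
  proof (rule ccontr)
    assume "suminf L \<noteq> 1"
    moreover have "suminf L \<le> 1" using L1 sL by (intro suminf_le_const)
    ultimately have "suminf L < 1" by simp
    from convex_deficient_not_optimal[OF a L0 LD summable_sums[OF sL] this]
    obtain q where "convex_pmf q" "?D (pmf q) < ?D L" by auto
    with I_le[of "pmf q"] DL show False by auto
  qed
  then have "L sums 1" using sL by (auto simp: sums_iff)
  then obtain p where p: "pmf p = L" using ex_pmf_nat[of L] L0 by blast
  have "convex_pmf p" using LD by (simp add: convex_pmf_def p)
  moreover have "?D (pmf p) \<le> ?D (pmf q)" if "convex_pmf q" for q
    using DL I_le[of "pmf q"] that by (auto simp: p)
  ultimately show "\<exists>p. convex_pmf p \<and> (\<forall>q. convex_pmf q \<longrightarrow> ?D (pmf p) \<le> ?D (pmf q))" by blast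
  fix p q
  assume p: "convex_pmf p \<and> (\<forall>q. convex_pmf q \<longrightarrow> ?D (pmf p) \<le> ?D (pmf q))"
    and q: "convex_pmf q \<and> (\<forall>r. convex_pmf r \<longrightarrow> ?D (pmf q) \<le> ?D (pmf r))"
  obtain r where r: "convex_pmf r"
      "?D (pmf r) = (?D (pmf p) + ?D (pmf q)) / 2 - ?Q (pmf p) (pmf q) / 4"
    using convex_pmf_midpoint[OF conjunct1[OF p] conjunct1[OF q] a2] by blast
  have "?D (pmf p) \<le> ?D (pmf q)" "?D (pmf q) \<le> ?D (pmf p)" "?D (pmf p) \<le> ?D (pmf r)"
    using p q r(1) by blast+
  then have "?Q (pmf p) (pmf q) \<le> 0" using r(2) by argo
  then have "(pmf p j - pmf q j)\<^sup>2 \<le> 0" for j using sq_le[of p j q] by argo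
  then show "p = q" by (intro pmf_eqI) simp
qed

section \<open>The empirical pmf and the stability of its convex least squares fit\<close>

lemma emp_pmf_nonneg: "0 \<le> emp_pmf xs j"
  by (simp add: emp_pmf_def)

lemma sum_emp_pmf:
  assumes "xs \<noteq> []" "finite A" "set xs \<subseteq> A"
  shows "(\<Sum>j\<in>A. emp_pmf xs j) = 1"
proof -
  have "(\<Sum>j\<in>A. count_list xs j) = (\<Sum>j\<in>set xs. count_list xs j)"
    using assms by (intro sum.mono_neutral_right) (auto simp: count_list_0_iff)
  then have "(\<Sum>j\<in>A. real (count_list xs j)) = real (length xs)"
    by (simp add: sum_count_set flip: of_nat_sum)
  then show ?thesis
    using assms(1) by (simp add: emp_pmf_def flip: sum_divide_distrib)
qed

text \<open>Since \<open>p\<close> competes with the estimator, both are within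
  \<open>(s + 1) * r\<close> of the empirical pmf in every coordinate, hence within twice that of
  each other. The weights 1, 2, 1 in \<open>Delta\<close> multiply this by 4, whence the factor
  8.\<close>

lemma conv_lse_close:
  assumes "xs \<noteq> []" "convex_pmf p"
    and close: "\<And>j. j \<le> s \<Longrightarrow> \<bar>emp_pmf xs j - pmf p j\<bar> \<le> r"
    and supp: "\<And>x. x \<in> set xs \<Longrightarrow> x \<le> s" "\<And>j. s < j \<Longrightarrow> pmf p j = 0"
  shows "\<bar>Delta (pmf (conv_lse xs)) k - Delta (pmf p) k\<bar> \<le> 8 * (real (s + 1) * r)"
proof -
  let ?a = "emp_pmf xs" and ?l = "pmf (conv_lse xs)"
  have as: "?a j = 0" if "s < j" for j
    using that supp(1) by (force simp: emp_pmf_def count_list_0_iff)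
  have a1: "(\<Sum>j\<le>s. ?a j) = 1"
    using supp(1) by (intro sum_emp_pmf[OF assms(1)]) auto
  have lse: "convex_pmf (conv_lse xs) \<and> (\<forall>q. convex_pmf q \<longrightarrow>
      (\<Sum>j. (?a j - ?l j)\<^sup>2) \<le> (\<Sum>j. (?a j - pmf q j)\<^sup>2))"
    unfolding conv_lse_def by (rule theI'[OF convex_lse_ex1[OF emp_pmf_nonneg as a1]])
  have a2: "summable (\<lambda>j. (?a j)\<^sup>2)"
    by (rule summable_finite[of "{..s}"]) (use as in auto)
  have r0: "0 \<le> r" using close[of 0] by simp
  have "(\<Sum>j. (?a j - pmf p j)\<^sup>2) = (\<Sum>j\<le>s. (?a j - pmf p j)\<^sup>2)"
    by (rule suminf_finite) (auto simp: as supp(2))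
  also have "\<dots> \<le> (\<Sum>j\<le>s. r\<^sup>2)"
    using close r0 by (intro sum_mono) (metis abs_le_square_iff abs_of_nonneg atMost_iff)
  also have "\<dots> \<le> (real (s + 1) * r)\<^sup>2"
  proof -
    have "real (s + 1) * r\<^sup>2 \<le> (real (s + 1))\<^sup>2 * r\<^sup>2"
      by (intro mult_right_mono self_le_power) auto
    then show ?thesis by (simp add: power_mult_distrib)
  qed
  finally have le: "(\<Sum>j. (?a j - pmf p j)\<^sup>2) \<le> (real (s + 1) * r)\<^sup>2" .
  have 1: "\<bar>?a j - ?l j\<bar> \<le> real (s + 1) * r" for j
  proof -
    have "(?a j - ?l j)\<^sup>2 \<le> (\<Sum>j. (?a j - ?l j)\<^sup>2)"
      using sum_le_suminf[OF summable_sq_diff[OF a2 summable_pmf_sq], of "{j}"] by simp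
    also have "\<dots> \<le> (real (s + 1) * r)\<^sup>2" by (rule order_trans[OF _ le]) (use lse assms(2) in blast)
    finally show ?thesis using r0 abs_le_square_iff[of "?a j - ?l j" "real (s + 1) * r"] by simp
  qed
  have 2: "\<bar>?a j - pmf p j\<bar> \<le> real (s + 1) * r" for j
  proof -
    have "\<bar>?a j - pmf p j\<bar> \<le> r"
      using close[of j] as[of j] supp(2)[of j] r0 by (cases "j \<le> s") auto
    also have "\<dots> \<le> real (s + 1) * r" using r0 by (simp add: algebra_simps)
    finally show ?thesis .
  qed
  have "\<bar>?l j - pmf p j\<bar> \<le> 2 * (real (s + 1) * r)" for j using 1[of j] 2[of j] by linarith
  from this[of "Suc k"] this[of k] this[of "k - 1"]
  show ?thesis unfolding Delta_def by linarith
qed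

section \<open>Gaussian vectors\<close>

text \<open>After division by the total mass, \<open>W\<close> is a probability density under both
  measures. The hypothesis makes the characteristic functions of \<open>X\<close> under these
  densities agree, and Levy's uniqueness theorem applies.\<close>

lemma weighted_law_eq:
  fixes M N :: "'a measure" and X W :: "'a \<Rightarrow> real"
  assumes "prob_space M" "prob_space N" and sets: "sets N = sets M"
    and X [measurable]: "X \<in> borel_measurable M" and W [measurable]: "W \<in> borel_measurable M"
    and W0: "\<And>x. 0 \<le> W x" and WC: "\<And>x. W x \<le> C"
    and eq: "\<And>s \<phi>. (\<integral>x. W x * cos (s * X x + \<phi>) \<partial>M) = (\<integral>x. W x * cos (s * X x + \<phi>) \<partial>N)"
    and B [measurable]: "B \<in> sets borel"
  shows "(\<integral>x. W x * indicator B (X x) \<partial>M) = (\<integral>x. W x * indicator B (X x) \<partial>N)"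
proof -
  interpret M: prob_space M by fact
  interpret N: prob_space N by fact
  note [measurable_cong] = sets
  have bound: "\<bar>W x\<bar> \<le> C" for x using W0 WC by simp
  have iM: "integrable M W" by (rule M.integrable_const_bound[where B=C]) (auto simp: bound)
  have iN: "integrable N W" by (rule N.integrable_const_bound[where B=C]) (auto simp: bound)
  define c where "c = (\<integral>x. W x \<partial>M)"
  have cN: "c = (\<integral>x. W x \<partial>N)" using eq[of 0 0] by (simp add: c_def)
  have c0: "0 \<le> c" using W0 by (simp add: c_def)
  show ?thesis
  \<comment> \<open>With zero total mass no normalisation is possible, but then \<open>W\<close>
    vanishes almost everywhere under both measures.\<close>
  proof (cases "c = 0")
    case True
    have "AE x in M. W x = 0"
      using integral_nonneg_eq_0_iff_AE[OF iM] True W0 by (simp add: c_def)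
    then have "(\<integral>x. W x * indicator B (X x) \<partial>M) = 0"
      by (intro integral_eq_zero_AE) auto
    moreover have "AE x in N. W x = 0"
      using integral_nonneg_eq_0_iff_AE[OF iN] True W0 by (simp add: cN)
    then have "(\<integral>x. W x * indicator B (X x) \<partial>N) = 0"
      by (intro integral_eq_zero_AE) auto
    ultimately show ?thesis by simp
  next
    case False
    with c0 have cpos: "0 < c" by simp
    define law where "law R = distr (density R (\<lambda>x. W x / c)) borel X" for R :: "'a measure"
    have law: "real_distribution (law R) \<and> measure (law R) B = (\<integral>x. W x * indicator B (X x) \<partial>R) / c
      \<and> (\<forall>s. char (law R) s = Complex ((\<integral>x. W x * cos (s * X x + 0) \<partial>R) / c)
            ((\<integral>x. W x * cos (s * X x + (- pi / 2)) \<partial>R) / c))"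
      if R: "prob_space R" and [measurable_cong]: "sets R = sets M" and Rc: "(\<integral>x. W x \<partial>R) = c" for R
    proof -
      interpret R: prob_space R by fact
      have iR: "integrable R W" by (rule R.integrable_const_bound[where B=C]) (auto simp: bound)
      have iR': "integrable R (\<lambda>x. W x * f x)" if [measurable]: "f \<in> borel_measurable R" and "\<And>x. \<bar>f x\<bar> \<le> 1" for f
      proof (rule R.integrable_const_bound[where B=C])
        show "AE x in R. norm (W x * f x) \<le> C"
          using that(2) W0 WC by (intro AE_I2) (simp add: abs_mult, metis abs_ge_zero mult.right_neutral mult_mono order_trans)
      qed auto
      have [measurable]: "X \<in> borel_measurable R" "W \<in> borel_measurable R" by measurable
      have "emeasure (density R (\<lambda>x. W x / c)) (space R) = (\<integral>\<^sup>+x. ennreal (W x / c) \<partial>R)"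
        by (subst emeasure_density) (auto intro!: nn_integral_cong)
      also have "\<dots> = ennreal (\<integral>x. W x / c \<partial>R)"
        using iR W0 c0 by (intro nn_integral_eq_integral) auto
      finally have "prob_space (density R (\<lambda>x. W x / c))"
        using Rc cpos by (intro prob_spaceI) simp
      then have "prob_space (law R)"
        unfolding law_def by (rule prob_space.prob_space_distr) measurable
      then have rd: "real_distribution (law R)"
        unfolding real_distribution_def real_distribution_axioms_def by (simp add: law_def)
      then interpret L: real_distribution "law R" .
      have "measure (law R) B = (\<integral>x. indicator B x \<partial>law R)" by simp
      also have "\<dots> = (\<integral>x. indicator B (X x) \<partial>density R (\<lambda>x. W x / c))"
        unfolding law_def by (rule integral_distr) measurable
      also have "\<dots> = (\<integral>x. (W x / c) *\<^sub>R indicator B (X x) \<partial>R)"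
        by (rule integral_density) (use W0 c0 in auto)
      also have "\<dots> = (\<integral>x. W x * indicator B (X x) \<partial>R) / c"
        by (simp flip: integral_divide_zero)
      finally have 1: "measure (law R) B = (\<integral>x. W x * indicator B (X x) \<partial>R) / c" .
      \<comment> \<open>The phases 0 and \<open>- pi / 2\<close> give the real and the imaginary
        part, the second because it turns the cosine into a sine.\<close>
      have 2: "char (law R) s = Complex ((\<integral>x. W x * cos (s * X x + 0) \<partial>R) / c)
            ((\<integral>x. W x * cos (s * X x + (- pi / 2)) \<partial>R) / c)" for s
      proof -
        have "char (law R) s = (\<integral>x. iexp (s * X x) \<partial>density R (\<lambda>x. W x / c))"
          unfolding char_def law_def by (rule integral_distr) measurable
        also have "\<dots> = (\<integral>x. (W x / c) *\<^sub>R iexp (s * X x) \<partial>R)"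
          by (rule integral_density) (use W0 c0 in auto)
        also have "\<dots> = (\<integral>x. complex_of_real (W x * cos (s * X x) / c)
            + \<i> * complex_of_real (W x * sin (s * X x) / c) \<partial>R)"
          by (intro Bochner_Integration.integral_cong refl) (simp add: complex_eq_iff Re_exp Im_exp)
        also have "\<dots> = complex_of_real (\<integral>x. W x * cos (s * X x) / c \<partial>R)
            + \<i> * complex_of_real (\<integral>x. W x * sin (s * X x) / c \<partial>R)"
          using iR'[of "\<lambda>x. cos (s * X x)"] iR'[of "\<lambda>x. sin (s * X x)"]
          by (subst Bochner_Integration.integral_add)
            (auto simp del: of_real_divide of_real_mult)
        also have "\<dots> = Complex ((\<integral>x. W x * cos (s * X x) \<partial>R) / c) ((\<integral>x. W x * sin (s * X x) \<partial>R) / c)"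
          by (simp add: complex_eq_iff)
        finally show ?thesis by (simp add: cos_diff)
      qed
      show ?thesis using rd 1 2 by blast
    qed
    note lM = law[OF \<open>prob_space M\<close> refl c_def[symmetric]]
      and lN = law[OF \<open>prob_space N\<close> sets cN[symmetric]]
    have "char (law M) s = char (law N) s" for s
      using lM[THEN conjunct2, THEN conjunct2, rule_format, of s]
        lN[THEN conjunct2, THEN conjunct2, rule_format, of s] by (simp only: eq)
    then have "char (law M) = char (law N)" ..
    then have "law M = law N" using lM lN by (intro Levy_uniqueness) auto
    then show ?thesis using lM lN False by simp
  qed
qed

text \<open>The Cramer--Wold device, one coordinate at a time: in the induction over \<open>k\<close> the exponential factor of the
  first \<open>k\<close> coordinates has been traded for indicators. The weight \<open>1 + cos\<close> keeps the measures nonnegative, so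
  that the one-dimensional uniqueness theorem applies.\<close>
lemma PiM_law_eqI_cos:
  fixes P Q :: "(nat \<Rightarrow> real) measure"
  assumes P: "prob_space P" and Q: "prob_space Q"
    and sP: "sets P = sets (PiM {..<d} (\<lambda>_. borel))" and sQ: "sets Q = sets (PiM {..<d} (\<lambda>_. borel))"
    and eq: "\<And>t \<theta>. (\<integral>x. cos ((\<Sum>i<d. t i * x i) + \<theta>) \<partial>P) = (\<integral>x. cos ((\<Sum>i<d. t i * x i) + \<theta>) \<partial>Q)"
  shows "P = Q"
proof -
  interpret P: prob_space P by fact
  interpret Q: prob_space Q by fact
  have sPQ: "sets Q = sets P" using sP sQ by simp
  have mP: "(\<lambda>x. x i) \<in> borel_measurable P" if "i < d" for i
    using measurable_component_singleton[of i "{..<d}" "\<lambda>_. borel"] that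
    by (simp cong: measurable_cong_sets add: sP)
  have mQ: "f \<in> borel_measurable Q \<longleftrightarrow> f \<in> borel_measurable P" for f :: "_ \<Rightarrow> real"
    by (simp cong: measurable_cong_sets add: sPQ)
  \<comment> \<open>\<open>w\<close> holds the indicators of the coordinates already treated,
    \<open>y\<close> the linear form in those still to come.\<close>
  define w where "w A k x = (\<Prod>i<k. indicator (A i) (x i) :: real)" for A k and x :: "nat \<Rightarrow> real"
  define y where "y t k x = (\<Sum>i\<in>{k..<d}. t i * x i)" for t k and x :: "nat \<Rightarrow> real"
  have w01: "0 \<le> w A k x" "w A k x \<le> 1" for A k x
    unfolding w_def by (auto intro!: prod_nonneg prod_le_1 simp: indicator_def)
  have mw: "w A k \<in> borel_measurable P" if "k \<le> d" "\<And>i. A i \<in> sets borel" for A k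
    unfolding w_def using that
    by (intro borel_measurable_prod measurable_compose[OF mP borel_measurable_indicator]) auto
  have my: "y t k \<in> borel_measurable P" for t k
    unfolding y_def by (intro borel_measurable_sum borel_measurable_times borel_measurable_const mP) auto
  have ywc: "y (t(k := s)) k x = s * x k + y t (Suc k) x" if "k < d" for t k s x
  proof -
    have "{k..<d} = insert k {Suc k..<d}" using that by auto
    then show ?thesis by (simp add: y_def)
  qed
  have int: "integrable P (\<lambda>x. w A k x * f x)" "integrable Q (\<lambda>x. w A k x * f x)"
    if "k \<le> d" "\<And>i. A i \<in> sets borel" "f \<in> borel_measurable P" "\<And>x. \<bar>f x\<bar> \<le> 1" for A k f
  proof -
    have "\<bar>w A k x * f x\<bar> \<le> 1" for x
      using w01[of A k x] that(4)[of x] by (simp add: abs_mult mult_le_one)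
    moreover have "(\<lambda>x. w A k x * f x) \<in> borel_measurable P"
      using mw[OF that(1,2)] that(3) by (rule borel_measurable_times)
    ultimately show "integrable P (\<lambda>x. w A k x * f x)" "integrable Q (\<lambda>x. w A k x * f x)"
      by (auto intro!: P.integrable_const_bound[where B=1] Q.integrable_const_bound[where B=1] simp: mQ)
  qed
  have claim: "(\<integral>x. w A k x * cos (y t k x + \<theta>) \<partial>P) = (\<integral>x. w A k x * cos (y t k x + \<theta>) \<partial>Q)"
    if "k \<le> d" "\<And>i. A i \<in> sets borel" for k A t \<theta>
    using that
  proof (induction k arbitrary: t \<theta>)
    case 0
    then show ?case using eq[of t \<theta>] by (simp add: w_def y_def atLeast0LessThan)
  next
    case (Suc k)
    then have k: "k < d" "k \<le> d" and A: "\<And>i. A i \<in> sets borel" by auto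
    note IH = Suc.IH[OF k(2) A]
    let ?Y = "\<lambda>x. y t (Suc k) x + \<theta>"
    have [measurable]: "(\<lambda>x. x k) \<in> borel_measurable P" "y t (Suc k) \<in> borel_measurable P"
      using mP[OF k(1)] my by auto
    have mcos: "(\<lambda>x. cos (s * x k + c * ?Y x + \<phi>)) \<in> borel_measurable P" for s c \<phi>
      by measurable
    \<comment> \<open>The induction hypothesis ranges over all coefficients and phases, so the
      frequency \<open>s\<close> of \<open>x k\<close> and a factor \<open>c\<close> on the
      remaining form are free. The weight \<open>w\<close> takes \<open>c = 0\<close>; the weight
      with \<open>1 + cos\<close> takes \<open>c\<close> in 0, 1, -1 by the product formula for
      cosines.\<close>
    have IH': "(\<integral>x. w A k x * cos (s * x k + c * ?Y x + \<phi>) \<partial>P) = (\<integral>x. w A k x * cos (s * x k + c * ?Y x + \<phi>) \<partial>Q)" for s c \<phi>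
    proof -
      have "y ((\<lambda>i. c * t i)(k := s)) k x + (c * \<theta> + \<phi>) = s * x k + c * ?Y x + \<phi>" for x
        unfolding ywc[OF k(1)] by (simp add: y_def sum_distrib_left algebra_simps)
      then show ?thesis using IH[of "(\<lambda>i. c * t i)(k := s)" "c * \<theta> + \<phi>"] by (simp only:)
    qed
    have 1: "(\<integral>x. w A k x * indicator (A k) (x k) \<partial>P) = (\<integral>x. w A k x * indicator (A k) (x k) \<partial>Q)"
    proof (rule weighted_law_eq[OF P Q sPQ, where C=1])
      show "(\<integral>x. w A k x * cos (s * x k + \<phi>) \<partial>P) = (\<integral>x. w A k x * cos (s * x k + \<phi>) \<partial>Q)" for s \<phi>
        using IH'[of s 0 \<phi>] by simp
    qed (use w01 mw[OF k(2) A] A mP[OF k(1)] in auto)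
    have 2: "(\<integral>x. (w A k x * (1 + cos (?Y x))) * indicator (A k) (x k) \<partial>P)
        = (\<integral>x. (w A k x * (1 + cos (?Y x))) * indicator (A k) (x k) \<partial>Q)"
    proof (rule weighted_law_eq[OF P Q sPQ, where C=2])
      show "0 \<le> w A k x * (1 + cos (?Y x))" for x
        using w01[of A k x] cos_ge_minus_one[of "?Y x"] by (intro mult_nonneg_nonneg) linarith+
      show "w A k x * (1 + cos (?Y x)) \<le> 2" for x
        using w01[of A k x] cos_ge_minus_one[of "?Y x"] cos_le_one[of "?Y x"]
          mult_mono[of "w A k x" 1 "1 + cos (?Y x)" 2] by linarith
      show "(\<lambda>x. w A k x * (1 + cos (?Y x))) \<in> borel_measurable P"
        using mcos[of 0 1 0] mw[OF k(2) A] by (intro borel_measurable_times borel_measurable_add) simp_all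
      show "(\<integral>x. w A k x * (1 + cos (?Y x)) * cos (s * x k + \<phi>) \<partial>P) =
            (\<integral>x. w A k x * (1 + cos (?Y x)) * cos (s * x k + \<phi>) \<partial>Q)" for s \<phi>
      proof -
        define g :: "real \<Rightarrow> (nat \<Rightarrow> real) \<Rightarrow> real" where "g c x = w A k x * cos (s * x k + c * ?Y x + \<phi>)" for c x
        have split: "w A k x * (1 + cos (?Y x)) * cos (s * x k + \<phi>) = g 0 x + (g 1 x / 2 + g (-1) x / 2)" for x
        proof -
          have "cos a * cos b = cos (b + a) / 2 + cos (b - a) / 2" for a b :: real
            by (simp add: cos_add cos_diff field_simps)
          from this[of "?Y x" "s * x k + \<phi>"] show ?thesis by (simp add: g_def algebra_simps)
        qed
        have g_eq: "g c = (\<lambda>x. w A k x * cos (s * x k + c * ?Y x + \<phi>))" for c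
          by (simp add: g_def fun_eq_iff)
        have i: "integrable P (g c)" "integrable Q (g c)" for c
          unfolding g_eq by (rule int[OF k(2) A mcos], simp)+
        have "(\<integral>x. g c x \<partial>P) = (\<integral>x. g c x \<partial>Q)" for c
          unfolding g_def by (rule IH')
        moreover have "(\<integral>x. g 0 x + (g 1 x / 2 + g (-1) x / 2) \<partial>R)
            = (\<integral>x. g 0 x \<partial>R) + ((\<integral>x. g 1 x \<partial>R) / 2 + (\<integral>x. g (-1) x \<partial>R) / 2)"
          if "integrable R (g 0)" "integrable R (g 1)" "integrable R (g (-1))" for R
          using that by simp
        ultimately show ?thesis unfolding split using i by presburger
      qed
    qed (use A mP[OF k(1)] in auto)
    have mi: "(\<lambda>x. indicator (A k) (x k) :: real) \<in> borel_measurable P"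
      by (rule measurable_compose[OF mP[OF k(1)]]) (use A in auto)
    have w_Suc: "w A (Suc k) x = w A k x * indicator (A k) (x k)" for x by (simp add: w_def)
    \<comment> \<open>Subtracting the identity for the weight \<open>w\<close> from that for
      \<open>w * (1 + cos)\<close> leaves the bare cosine of the remaining form.\<close>
    have eq3: "w A (Suc k) x * cos (?Y x) = (w A k x * (1 + cos (?Y x))) * indicator (A k) (x k)
        - w A k x * indicator (A k) (x k)" for x by (simp add: w_Suc algebra_simps)
    have i1: "integrable P (\<lambda>x. w A k x * indicator (A k) (x k))" "integrable Q (\<lambda>x. w A k x * indicator (A k) (x k))"
      using int[OF k(2) A mi] by (auto simp: indicator_def)
    have i2: "integrable P (\<lambda>x. w A (Suc k) x * cos (?Y x))" "integrable Q (\<lambda>x. w A (Suc k) x * cos (?Y x))"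
      using int[OF Suc.prems mcos[of 0 1 0]] by auto
    have i3: "integrable P (\<lambda>x. (w A k x * (1 + cos (?Y x))) * indicator (A k) (x k))"
        "integrable Q (\<lambda>x. (w A k x * (1 + cos (?Y x))) * indicator (A k) (x k))"
      using Bochner_Integration.integrable_add[OF i2(1) i1(1)] Bochner_Integration.integrable_add[OF i2(2) i1(2)]
      unfolding eq3 by simp_all
    show ?case unfolding eq3 using i1 i3 1 2 by simp
  qed
  show ?thesis
  proof (rule measure_eqI_PiM_finite[OF _ sP sQ])
    fix A :: "nat \<Rightarrow> real set" assume A: "\<And>i. i \<in> {..<d} \<Longrightarrow> A i \<in> sets borel"
    \<comment> \<open>The claim asks for Borel sets at every index, while \<open>A\<close> is known
      to be Borel only below \<open>d\<close>; the empty set is the default beyond.\<close>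
    let ?A = "\<lambda>i. if i < d then A i else {}"
    have A': "?A i \<in> sets borel" for i using A by auto
    have spc: "space P = extensional {..<d}" "space Q = extensional {..<d}"
      using sets_eq_imp_space_eq[OF sP] sets_eq_imp_space_eq[OF sQ] by (auto simp: space_PiM PiE_def)
    have ind: "w ?A d x = indicator (Pi\<^sub>E {..<d} A) x" if "x \<in> extensional {..<d}" for x
      using that by (auto simp: w_def indicator_def PiE_def Pi_def intro!: prod.neutral)
    have S: "Pi\<^sub>E {..<d} A \<in> sets P" using A unfolding sP by (intro sets_PiM_I_finite) auto
    have "measure P (Pi\<^sub>E {..<d} A) = (\<integral>x. indicator (Pi\<^sub>E {..<d} A) x \<partial>P)" using S by simp
    also have "\<dots> = (\<integral>x. w ?A d x \<partial>P)" by (intro Bochner_Integration.integral_cong) (auto simp: ind spc)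
    \<comment> \<open>At level \<open>d\<close> the remaining form is an empty sum, so the cosine
      factor is 1.\<close>
    also have "\<dots> = (\<integral>x. w ?A d x \<partial>Q)" using claim[of d ?A "\<lambda>_. 0" 0] A' by (simp add: y_def)
    also have "\<dots> = (\<integral>x. indicator (Pi\<^sub>E {..<d} A) x \<partial>Q)" by (intro Bochner_Integration.integral_cong) (auto simp: ind spc)
    also have "\<dots> = measure Q (Pi\<^sub>E {..<d} A)" using S by (simp add: sPQ)
    finally show "emeasure P (Pi\<^sub>E {..<d} A) = emeasure Q (Pi\<^sub>E {..<d} A)"
      by (simp add: P.emeasure_eq_measure Q.emeasure_eq_measure)
  next
    show "range (\<lambda>_. Pi\<^sub>E {..<d} (\<lambda>_. UNIV)) \<subseteq> prod_algebra {..<d} (\<lambda>_. borel :: real measure)"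
      by (auto intro!: prod_algebraI_finite)
  qed (auto simp: space_PiM)
qed

section \<open>Linear images of a standard normal vector\<close>

lemma prob_space_std_normal_vec: "prob_space (std_normal_vec d)"
  unfolding std_normal_vec_def by (intro prob_space_PiM prob_space_normal_density) simp

lemma sets_std_normal_vec [measurable_cong]: "sets (std_normal_vec d) = sets (PiM {..<d} (\<lambda>_. borel))"
  unfolding std_normal_vec_def by (rule sets_PiM_cong) auto

text \<open>By independence the characteristic function is a product of one-dimensional ones, which
  are real; rotating by \<open>\<theta>\<close> and taking real parts gives the formula.\<close>

lemma std_normal_vec_cos:
  "(\<integral>z. cos ((\<Sum>k<d. u k * z k) + \<theta>) \<partial>std_normal_vec d) = cos \<theta> * exp (- (\<Sum>k<d. (u k)\<^sup>2) / 2)"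
proof -
  interpret product_sigma_finite "\<lambda>_ :: nat. std_normal_distribution"
    by (intro product_sigma_finite.intro prob_space_imp_sigma_finite prob_space_normal_density) simp
  interpret S: prob_space "std_normal_vec d" by (rule prob_space_std_normal_vec)
  interpret N: real_distribution std_normal_distribution by (rule real_dist_normal_dist)
  have m: "(\<lambda>z. (\<Sum>k<d. u k * z k) + \<theta>) \<in> borel_measurable (std_normal_vec d)" by measurable
  have "(\<integral>z. (\<Prod>k\<in>{..<d}. iexp (u k * z k)) \<partial>std_normal_vec d)
      = (\<Prod>k\<in>{..<d}. \<integral>x. iexp (u k * x) \<partial>std_normal_distribution)"
    unfolding std_normal_vec_def by (rule product_integral_prod) (auto intro!: N.integrable_iexp)
  also have "\<dots> = (\<Prod>k\<in>{..<d}. complex_of_real (exp (- (u k)\<^sup>2 / 2)))"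
    using char_std_normal_distribution by (simp add: char_def fun_eq_iff)
  also have "\<dots> = complex_of_real (exp (- (\<Sum>k<d. (u k)\<^sup>2) / 2))"
    by (simp add: sum_divide_distrib sum_negf[symmetric] exp_sum del: sum_negf)
  finally have *: "(\<integral>z. (\<Prod>k\<in>{..<d}. iexp (u k * z k)) \<partial>std_normal_vec d) = \<dots>" .
  have "iexp \<theta> * complex_of_real (exp (- (\<Sum>k<d. (u k)\<^sup>2) / 2))
      = (\<integral>z. iexp \<theta> * (\<Prod>k\<in>{..<d}. iexp (u k * z k)) \<partial>std_normal_vec d)"
    by (simp only: integral_mult_right_zero *)
  also have "\<dots> = (\<integral>z. iexp ((\<Sum>k<d. u k * z k) + \<theta>) \<partial>std_normal_vec d)"
    by (intro Bochner_Integration.integral_cong refl)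
      (simp add: exp_sum[symmetric] exp_add[symmetric] sum_distrib_left algebra_simps)
  finally have "Re (iexp \<theta> * complex_of_real (exp (- (\<Sum>k<d. (u k)\<^sup>2) / 2)))
      = Re (\<integral>z. iexp ((\<Sum>k<d. u k * z k) + \<theta>) \<partial>std_normal_vec d)" by simp
  also have "\<dots> = (\<integral>z. Re (iexp ((\<Sum>k<d. u k * z k) + \<theta>)) \<partial>std_normal_vec d)"
    using m by (intro integral_Re[symmetric] S.integrable_iexp) auto
  finally show ?thesis by (simp add: Re_exp)
qed

definition lin_image :: "nat \<Rightarrow> (nat \<Rightarrow> nat \<Rightarrow> real) \<Rightarrow> (nat \<Rightarrow> real) \<Rightarrow> nat \<Rightarrow> real" where
  "lin_image d A z = (\<lambda>i\<in>{..<d}. \<Sum>k<d. A i k * z k)"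

lemma measurable_lin_image [measurable]:
  "lin_image d A \<in> measurable (std_normal_vec d) (PiM {..<d} (\<lambda>_. borel))"
  unfolding lin_image_def by (rule measurable_restrict) measurable

text \<open>The cosine transform of the image under \<open>A\<close> involves \<open>A\<close> only
  through the quadratic form of its Gram matrix, and this transform determines the law.\<close>

lemma distr_lin_image_eq:
  assumes "\<And>i j. i < d \<Longrightarrow> j < d \<Longrightarrow> (\<Sum>k<d. A i k * A j k) = (\<Sum>k<d. B i k * B j k)"
  shows "distr (std_normal_vec d) (PiM {..<d} (\<lambda>_. borel)) (lin_image d A)
    = distr (std_normal_vec d) (PiM {..<d} (\<lambda>_. borel)) (lin_image d B)" (is "?L A = ?L B")
proof (rule PiM_law_eqI_cos)
  interpret S: prob_space "std_normal_vec d" by (rule prob_space_std_normal_vec)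
  show "prob_space (?L A)" "prob_space (?L B)" by (auto intro!: S.prob_space_distr)
  have *: "(\<integral>x. cos ((\<Sum>i<d. t i * x i) + \<theta>) \<partial>?L A)
      = cos \<theta> * exp (- (\<Sum>i<d. \<Sum>j<d. t i * t j * (\<Sum>k<d. A i k * A j k)) / 2)" for t \<theta> A
  proof -
    have "(\<integral>x. cos ((\<Sum>i<d. t i * x i) + \<theta>) \<partial>?L A)
        = (\<integral>z. cos ((\<Sum>i<d. t i * lin_image d A z i) + \<theta>) \<partial>std_normal_vec d)"
      by (rule integral_distr) measurable
    also have "\<dots> = (\<integral>z. cos ((\<Sum>k<d. (\<Sum>i<d. t i * A i k) * z k) + \<theta>) \<partial>std_normal_vec d)"
    proof -
      have "(\<Sum>i<d. t i * lin_image d A z i) = (\<Sum>k<d. (\<Sum>i<d. t i * A i k) * z k)" for z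
        by (simp add: lin_image_def sum_distrib_left sum_distrib_right mult.assoc)
          (rule sum.swap)
      then show ?thesis by simp
    qed
    also have "\<dots> = cos \<theta> * exp (- (\<Sum>k<d. (\<Sum>i<d. t i * A i k)\<^sup>2) / 2)" by (rule std_normal_vec_cos)
    also have "(\<Sum>k<d. (\<Sum>i<d. t i * A i k)\<^sup>2) = (\<Sum>k<d. \<Sum>i<d. \<Sum>j<d. t i * t j * (A i k * A j k))"
      by (simp add: power2_eq_square sum_product algebra_simps)
    also have "\<dots> = (\<Sum>i<d. \<Sum>j<d. \<Sum>k<d. t i * t j * (A i k * A j k))"
      by (subst sum.swap) (intro sum.cong refl sum.swap)
    finally show ?thesis by (simp add: sum_distrib_left)
  qed
  show "(\<integral>x. cos ((\<Sum>i<d. t i * x i) + \<theta>) \<partial>?L A) = (\<integral>x. cos ((\<Sum>i<d. t i * x i) + \<theta>) \<partial>?L B)" for t \<theta>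
    unfolding * using assms by simp
qed auto

text \<open>Frees \<open>gauss_vec\<close> from the arbitrary root picked by \<open>SOME\<close>:
  any explicit root of the covariance represents the same law.\<close>

lemma gauss_vec_eq:
  assumes "\<And>i j. i < d \<Longrightarrow> j < d \<Longrightarrow> (\<Sum>k<d. A i k * A j k) = C i j"
  shows "gauss_vec d C = distr (std_normal_vec d) (PiM {..<d} (\<lambda>_. borel)) (lin_image d A)"
proof -
  let ?B = "SOME A. \<forall>i<d. \<forall>j<d. (\<Sum>k<d. A i k * A j k) = C i j"
  have "\<forall>i<d. \<forall>j<d. (\<Sum>k<d. ?B i k * ?B j k) = C i j"
    by (rule someI[of _ A]) (use assms in auto)
  then have "distr (std_normal_vec d) (PiM {..<d} (\<lambda>_. borel)) (lin_image d ?B)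
    = distr (std_normal_vec d) (PiM {..<d} (\<lambda>_. borel)) (lin_image d A)"
    by (intro distr_lin_image_eq) (use assms in auto)
  then show ?thesis unfolding gauss_vec_def Let_def lin_image_def .
qed

section \<open>An explicit root of the multinomial covariance\<close>

definition multinom_root :: "(nat \<Rightarrow> real) \<Rightarrow> nat \<Rightarrow> nat \<Rightarrow> real" where
  "multinom_root q i k = (if i = k then sqrt (q i) else 0) - q i * sqrt (q k)"

text \<open>Let \<open>u\<close> be the vector of the \<open>sqrt (q k)\<close>, a unit vector
  because \<open>q\<close> sums to one. The root is \<open>diag u\<close> times the orthogonal
  projection \<open>I - u u^T\<close>, which is idempotent, so the product with its transpose is
  \<open>diag q - q q^T\<close>.\<close>

lemma multinom_root_cov:
  assumes q: "\<And>i. 0 \<le> q i" "(\<Sum>k<d. q k) = 1" and ij: "i < d" "j < d"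
  shows "(\<Sum>k<d. multinom_root q i k * multinom_root q j k) = multinom_cov q i j"
proof -
  have "(\<Sum>k<d. multinom_root q i k * multinom_root q j k) =
     (\<Sum>k<d. if i = k then (if i = j then q i else 0) else 0) - (\<Sum>k<d. if i = k then q j * q i else 0)
     - (\<Sum>k<d. if j = k then q i * q j else 0) + (\<Sum>k<d. q i * q j * q k)"
    unfolding sum_subtractf[symmetric] sum.distrib[symmetric]
    using q(1) by (intro sum.cong refl) (auto simp: multinom_root_def algebra_simps)
  also have "\<dots> = multinom_cov q i j"
    using ij q(2) by (simp add: multinom_cov_def sum_distrib_left[symmetric])
  finally show ?thesis .
qed

section \<open>Comparison of the two statistics\<close>

lemma abs_sqrt_diff_le:
  assumes "0 \<le> a" "0 \<le> b"
  shows "\<bar>sqrt a - sqrt b\<bar> \<le> sqrt \<bar>a - b\<bar>"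
  using sqrt_add_le_add_sqrt[of b "a - b"] sqrt_add_le_add_sqrt[of a "b - a"] assms
  by (cases "a \<le> b") auto

lemma multinom_root_bounds:
  assumes q: "\<And>i. 0 \<le> q i" "(\<Sum>k<d. q k) = 1" and q': "\<And>i. 0 \<le> q' i" "(\<Sum>k<d. q' k) = 1"
    and close: "\<And>i. i < d \<Longrightarrow> \<bar>q i - q' i\<bar> \<le> \<delta>" and "\<delta> \<le> 1" and ik: "i < d" "k < d"
  shows "\<bar>multinom_root q i k\<bar> \<le> 2" "\<bar>multinom_root q i k - multinom_root q' i k\<bar> \<le> 3 * sqrt \<delta>"
proof -
  have le1: "q j \<le> 1" "q' j \<le> 1" if "j < d" for j
    using member_le_sum[of j "{..<d}" q] member_le_sum[of j "{..<d}" q'] q q' that by auto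
  have d0: "0 \<le> \<delta>" using close[OF ik(1)] by simp
  have s1: "sqrt (q j) \<le> 1" "0 \<le> sqrt (q j)" if "j < d" for j using le1 that q(1) by auto
  have "\<bar>q i * sqrt (q k)\<bar> \<le> 1"
    using le1[OF ik(1)] s1[OF ik(2)] q(1) by (simp add: abs_mult mult_le_one)
  moreover have "\<bar>(if i = k then sqrt (q i) else 0) - t\<bar> \<le> 2" if "\<bar>t\<bar> \<le> 1" for t
  proof -
    have "0 \<le> (if i = k then sqrt (q i) else 0)" "(if i = k then sqrt (q i) else 0) \<le> 1"
      using s1[OF ik(1)] by auto
    with that show ?thesis by linarith
  qed
  ultimately show "\<bar>multinom_root q i k\<bar> \<le> 2" unfolding multinom_root_def by blast
  have sd: "\<bar>sqrt (q j) - sqrt (q' j)\<bar> \<le> sqrt \<delta>" if "j < d" for j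
    by (rule order_trans[OF abs_sqrt_diff_le[OF q(1) q'(1)]]) (use close[OF that] in simp)
  \<comment> \<open>The square root is only Hoelder of exponent 1/2 near 0, so all errors are
    measured in \<open>sqrt \<delta>\<close>: one from the diagonal and two from the product
    term.\<close>
  have "\<delta> \<le> sqrt \<delta>"
    using d0 \<open>\<delta> \<le> 1\<close> by (intro real_le_rsqrt) (simp add: power2_eq_square mult_left_le)
  have "q i * sqrt (q k) - q' i * sqrt (q' k)
      = (q i - q' i) * sqrt (q k) + q' i * (sqrt (q k) - sqrt (q' k))"
    by (simp add: algebra_simps)
  also have "\<bar>\<dots>\<bar> \<le> \<bar>q i - q' i\<bar> * sqrt (q k) + q' i * \<bar>sqrt (q k) - sqrt (q' k)\<bar>"
    using q'(1)[of i] s1[OF ik(2)] by (intro order_trans[OF abs_triangle_ineq]) (simp add: abs_mult)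
  also have "\<dots> \<le> \<delta> * 1 + 1 * sqrt \<delta>"
    using close[OF ik(1)] s1[OF ik(2)] sd[OF ik(2)] le1[OF ik(1)] q'(1)[of i] d0
    by (intro add_mono mult_mono) auto
  finally have "\<bar>q i * sqrt (q k) - q' i * sqrt (q' k)\<bar> \<le> 2 * sqrt \<delta>"
    using \<open>\<delta> \<le> sqrt \<delta>\<close> by simp
  then show "\<bar>multinom_root q i k - multinom_root q' i k\<bar> \<le> 3 * sqrt \<delta>"
    using sd[OF ik(1)] d0 by (auto simp: multinom_root_def)
qed

lemma sqrt_sqdist_le:
  assumes "\<And>i. i < d \<Longrightarrow> \<bar>f i - g i\<bar> \<le> c"
  shows "sqrt (sqdist d f g) \<le> real d * c"
proof -
  have "sqrt (sqdist d f g) \<le> (\<Sum>i<d. \<bar>f i - g i\<bar>)"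
    unfolding sqdist_eq_L2_set by (rule L2_set_le_sum_abs)
  also have "\<dots> \<le> (\<Sum>i<d. c)" using assms by (intro sum_mono) auto
  finally show ?thesis by simp
qed

lemma integrable_std_normal_vec_l1_sq:
  "integrable (std_normal_vec d) (\<lambda>z. (\<Sum>k<d. \<bar>z k\<bar>)\<^sup>2)"
proof (rule Bochner_Integration.integrable_bound)
  have "integrable (std_normal_vec d) (\<lambda>z. (z k)\<^sup>2)" if "k < d" for k
  proof -
    have "distr (std_normal_vec d) std_normal_distribution (\<lambda>z. z k) = std_normal_distribution"
      unfolding std_normal_vec_def
      using that by (intro distr_PiM_component prob_space_normal_density) auto
    then have "integrable (distr (std_normal_vec d) std_normal_distribution (\<lambda>z. z k)) (\<lambda>x. x\<^sup>2)"
      using integrable_std_normal_distribution_moment[of 2] by simp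
    then show ?thesis
      using that by (subst (asm) integrable_distr_eq) (auto simp: std_normal_vec_def)
  qed
  then show "integrable (std_normal_vec d) (\<lambda>z. (\<Sum>k<d. (z k)\<^sup>2) * real d)" by auto
  show "AE z in std_normal_vec d. norm ((\<Sum>k<d. \<bar>z k\<bar>)\<^sup>2) \<le> norm ((\<Sum>k<d. (z k)\<^sup>2) * real d)"
    using sum_squared_le_sum_of_squares[of "\<lambda>k. \<bar>z k\<bar>" "{..<d}" for z]
    by (intro AE_I2) (simp add: abs_mult sum_nonneg)
qed measurable

definition l1_sq_moment :: "nat \<Rightarrow> real" where
  "l1_sq_moment d = (\<integral>z. (\<Sum>k<d. \<bar>z k\<bar>)\<^sup>2 \<partial>std_normal_vec d)"

text \<open>A coupling: both vectors are images of one \<open>z\<close>. With \<open>Z\<close> the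
  l1 norm of \<open>z\<close>, their coordinates differ by at most
  \<open>3 * sqrt \<delta> * Z\<close> and are bounded by \<open>2 * Z\<close>; the local Lipschitz
  bound then yields the factor 12 and the square of \<open>Z\<close>.\<close>

lemma (in closed_midconvex) gauss_vec_BL_le:
  assumes q: "\<And>i. 0 \<le> q i" "(\<Sum>k<d. q k) = 1" and q': "\<And>i. 0 \<le> q' i" "(\<Sum>k<d. q' k) = 1"
    and close: "\<And>i. i < d \<Longrightarrow> \<bar>q i - q' i\<bar> \<le> \<delta>" and "\<delta> \<le> 1" and h: "h \<in> BL"
  shows "\<bar>(\<integral>g. h (sqdist d (proj d K g) g) \<partial>gauss_vec d (multinom_cov q))
      - (\<integral>g. h (sqdist d (proj d K g) g) \<partial>gauss_vec d (multinom_cov q'))\<bar>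
    \<le> 12 * (real d)\<^sup>2 * sqrt \<delta> * l1_sq_moment d"
proof -
  interpret S: prob_space "std_normal_vec d" by (rule prob_space_std_normal_vec)
  let ?T = "\<lambda>g. sqdist d (proj d K g) g"
  let ?x = "lin_image d (multinom_root q)" and ?y = "lin_image d (multinom_root q')"
  have hLip: "\<bar>h a - h b\<bar> \<le> \<bar>a - b\<bar>" and hb: "\<bar>h a\<bar> \<le> 1" for a b using h by (auto simp: BL_def)
  have "continuous_on UNIV h"
    by (rule lipschitz_on_continuous_on[of 1], rule lipschitz_onI) (use hLip in \<open>auto simp: dist_real_def\<close>)
  then have [measurable]: "h \<in> borel_measurable borel" by (rule borel_measurable_continuous_onI)
  have hT [measurable]: "(\<lambda>g. h (?T g)) \<in> borel_measurable (PiM {..<d} (\<lambda>_. borel))" by measurable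
  have q_eq: "(\<integral>g. h (?T g) \<partial>gauss_vec d (multinom_cov q)) = (\<integral>z. h (?T (?x z)) \<partial>std_normal_vec d)"
    by (subst gauss_vec_eq[OF multinom_root_cov[OF q]]) (auto intro!: integral_distr)
  have q'_eq: "(\<integral>g. h (?T g) \<partial>gauss_vec d (multinom_cov q')) = (\<integral>z. h (?T (?y z)) \<partial>std_normal_vec d)"
    by (subst gauss_vec_eq[OF multinom_root_cov[OF q']]) (auto intro!: integral_distr)
  have int: "integrable (std_normal_vec d) (\<lambda>z. h (?T (lin_image d A z)))" for A
    by (rule S.integrable_const_bound[where B=1])
      (auto simp: hb intro!: measurable_compose[OF measurable_lin_image hT])
  have le: "\<bar>h (?T (?x z)) - h (?T (?y z))\<bar> \<le> 12 * (real d)\<^sup>2 * sqrt \<delta> * (\<Sum>k<d. \<bar>z k\<bar>)\<^sup>2" for z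
  proof -
    define Z where "Z = (\<Sum>k<d. \<bar>z k\<bar>)"
    have Z0: "0 \<le> Z" by (simp add: Z_def sum_nonneg)
    have lin: "\<bar>\<Sum>k<d. A k * z k\<bar> \<le> c * Z" if "\<And>k. k < d \<Longrightarrow> \<bar>A k\<bar> \<le> c" for A c
    proof -
      have "\<bar>\<Sum>k<d. A k * z k\<bar> \<le> (\<Sum>k<d. \<bar>A k * z k\<bar>)" by (rule sum_abs)
      also have "\<dots> \<le> (\<Sum>k<d. c * \<bar>z k\<bar>)"
        using that by (intro sum_mono) (auto simp: abs_mult intro!: mult_right_mono)
      finally show ?thesis by (simp add: Z_def sum_distrib_left)
    qed
    note b = multinom_root_bounds[OF q q' close \<open>\<delta> \<le> 1\<close>]
    have b': "\<bar>multinom_root q' i k\<bar> \<le> 2" if "i < d" "k < d" for i k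
      using close by (intro multinom_root_bounds(1)[OF q' q _ \<open>\<delta> \<le> 1\<close>]) (auto simp: abs_minus_commute that)
    have xy: "\<bar>?x z i - ?y z i\<bar> \<le> 3 * sqrt \<delta> * Z" if "i < d" for i
      using that lin[of "\<lambda>k. multinom_root q i k - multinom_root q' i k" "3 * sqrt \<delta>"] b(2)[OF _ that]
      by (simp add: lin_image_def sum_subtractf left_diff_distrib)
    have x: "\<bar>?x z i - 0\<bar> \<le> 2 * Z" if "i < d" for i
      using that lin[of "multinom_root q i" 2] b(1)[OF _ that] by (simp add: lin_image_def)
    have y: "\<bar>?y z i - 0\<bar> \<le> 2 * Z" if "i < d" for i
      using that lin[of "multinom_root q' i" 2] b' by (simp add: lin_image_def)
    have "\<bar>h (?T (?x z)) - h (?T (?y z))\<bar> \<le> \<bar>?T (?x z) - ?T (?y z)\<bar>" by (rule hLip)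
    also have "\<dots> \<le> sqrt (sqdist d (?x z) (?y z)) *
        (sqrt (sqdist d (?x z) (\<lambda>_. 0)) + sqrt (sqdist d (?y z) (\<lambda>_. 0)))"
      by (rule abs_sqdist_proj_diff_le)
    also have "\<dots> \<le> (real d * (3 * sqrt \<delta> * Z)) * (real d * (2 * Z) + real d * (2 * Z))"
    proof (intro mult_mono add_mono sqrt_sqdist_le xy x y)
      have "0 \<le> sqrt (sqdist d (?x z) (?y z))" by simp
      also have "\<dots> \<le> real d * (3 * sqrt \<delta> * Z)" by (intro sqrt_sqdist_le xy)
      finally show "0 \<le> real d * (3 * sqrt \<delta> * Z)" .
    qed auto
    finally show ?thesis by (simp add: Z_def[symmetric] power2_eq_square algebra_simps)
  qed
  have "\<bar>(\<integral>z. h (?T (?x z)) \<partial>std_normal_vec d) - (\<integral>z. h (?T (?y z)) \<partial>std_normal_vec d)\<bar>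
      = \<bar>\<integral>z. h (?T (?x z)) - h (?T (?y z)) \<partial>std_normal_vec d\<bar>"
    using int by simp
  also have "\<dots> \<le> (\<integral>z. \<bar>h (?T (?x z)) - h (?T (?y z))\<bar> \<partial>std_normal_vec d)"
    by (rule integral_abs_bound)
  also have "\<dots> \<le> (\<integral>z. 12 * (real d)\<^sup>2 * sqrt \<delta> * (\<Sum>k<d. \<bar>z k\<bar>)\<^sup>2 \<partial>std_normal_vec d)"
    using int le integrable_std_normal_vec_l1_sq by (intro integral_mono) auto
  finally show ?thesis by (simp add: q_eq q'_eq l1_sq_moment_def)
qed

text \<open>The deterministic half of the theorem: the hypotheses describe the good event, on which
  both statistics are one function \<open>T0\<close> evaluated under two nearby Gaussian
  laws.\<close>

lemma cond_BL_dist_le: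
  assumes xs: "xs \<noteq> []" "\<And>x. x \<in> set xs \<Longrightarrow> x \<le> S"
    and p: "convex_pmf p" "set_pmf p = {0..S}"
    and close: "\<And>j. j \<le> S \<Longrightarrow> \<bar>emp_pmf xs j - pmf p j\<bar> < r"
    and r: "8 * (real (S + 1) * r) \<le> v" "r \<le> 1" "r \<le> pmf p S"
    and knots: "\<And>k. k \<in> {1..S} \<Longrightarrow> knot (pmf p) k \<Longrightarrow> 2 * v < Delta (pmf p) k"
  shows "cond_BL_dist xs v p S \<le> 12 * (real (S + 2))\<^sup>2 * sqrt r * l1_sq_moment (S + 2)"
proof -
  have supp: "pmf p j = 0" if "S < j" for j
    using that p(2) by (auto simp: pmf_eq_0_set_pmf)
  have emp0: "emp_pmf xs j = 0" if "S < j" for j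
    using that xs(2) by (force simp: emp_pmf_def count_list_0_iff)
  have r0: "0 \<le> r" using close[of 0] by simp
  \<comment> \<open>A deviation below the mass at \<open>S\<close> forces \<open>S\<close> to be
    observed, so the sample maximum is exactly \<open>S\<close>.\<close>
  have "0 < emp_pmf xs S" using close[of S] r(3) by simp
  then have "S \<in> set xs"
    by (auto simp: emp_pmf_def zero_less_divide_iff intro: ccontr)
  then have Smax: "sample_max xs = S"
    unfolding sample_max_def using xs(2) by (intro Max_eqI) auto
  have D: "\<bar>Delta (pmf (conv_lse xs)) k - Delta (pmf p) k\<bar> \<le> v" for k
    using conv_lse_close[OF xs(1) p(1) less_imp_le[OF close] xs(2) supp, of k] r(1) by linarith
  \<comment> \<open>The estimator's second differences err by at most \<open>v\<close>: where those
    of \<open>p\<close> vanish they stay at or below \<open>v\<close>, and where those of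
    \<open>p\<close> exceed \<open>2 * v\<close> they stay above it.\<close>
  have "Delta (pmf (conv_lse xs)) k \<le> v \<longleftrightarrow> \<not> knot (pmf p) k" if k: "k \<in> {1..S}" for k
  proof
    assume "Delta (pmf (conv_lse xs)) k \<le> v"
    then show "\<not> knot (pmf p) k" using knots[OF k] D[of k] by linarith
  next
    assume "\<not> knot (pmf p) k"
    then have "Delta (pmf p) k = 0" using p(1) k by (auto simp: knot_def convex_pmf_def intro: antisym)
    then show "Delta (pmf (conv_lse xs)) k \<le> v" using D[of k] by linarith
  qed
  then have K: "Kn xs v = K0 p S" by (auto simp: Kn_def K0_def Smax)
  interpret closed_midconvex "S + 2" "K0 p S" by (rule closed_midconvex_K0)
  have "(\<Sum>k<S + 2. pmf p k) = 1"
    using p(2) by (intro sum_pmf_eq_1) auto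
  moreover have "(\<Sum>k<S + 2. emp_pmf xs k) = 1"
    using xs(2) by (intro sum_emp_pmf[OF xs(1)]) (auto simp: less_Suc_eq_le le_SucI)
  moreover have "\<bar>emp_pmf xs i - pmf p i\<bar> \<le> r" for i
    using close[of i] emp0[of i] supp[of i] r0 by (cases "i \<le> S") auto
  ultimately have "\<bar>(\<integral>g. h (T0 p S g) \<partial>gauss_vec (S + 2) (multinom_cov (emp_pmf xs)))
      - (\<integral>g. h (T0 p S g) \<partial>gauss_vec (S + 2) (multinom_cov (pmf p)))\<bar>
      \<le> 12 * (real (S + 2))\<^sup>2 * sqrt r * l1_sq_moment (S + 2)" if "h \<in> BL" for h
    unfolding T0_def using that r(2)
    by (intro gauss_vec_BL_le emp_pmf_nonneg pmf_nonneg)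
  moreover have "Tn xs v = T0 p S" by (auto simp: Tn_def T0_def K Smax)
  moreover have "(\<lambda>_. 0) \<in> BL" by (simp add: BL_def)
  ultimately show ?thesis
    unfolding cond_BL_dist_def Smax by (intro cSUP_least) auto
qed

section \<open>Measurability of the sample and concentration of the empirical pmf\<close>

lemma emp_pmf_sample:
  "emp_pmf (sample X n \<omega>) j = (\<Sum>i\<in>{1..n}. indicator {j} (X i \<omega>)) / real n"
proof -
  have "real (count_list (map f xs) j) = (\<Sum>i\<leftarrow>xs. indicator {j} (f i))" for f and xs :: "nat list"
    by (induction xs) (auto simp: indicator_def)
  then show ?thesis
    by (simp add: emp_pmf_def sample_def interv_sum_list_conv_sum_set_nat atLeastLessThanSuc_atLeastAtMost
        del: upt_Suc)
qed

lemma measurable_map_count_space: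
  fixes X :: "nat \<Rightarrow> 'a \<Rightarrow> nat"
  assumes X: "\<And>i. X i \<in> measurable M (count_space UNIV)"
  shows "(\<lambda>\<omega>. map (\<lambda>i. X i \<omega>) xs) \<in> measurable M (count_space UNIV)"
proof (induction xs)
  case (Cons i xs)
  have "(\<lambda>\<omega>. (\<lambda>y. X i \<omega> # y) (map (\<lambda>i. X i \<omega>) xs)) \<in> measurable M (count_space UNIV)"
    by (rule measurable_compose_countable[OF _ Cons])
      (rule measurable_compose[OF X], simp)
  then show ?case by simp
qed simp

text \<open>Hoeffding's inequality for the indicators of \<open>X i = j\<close>, which are i.i.d.
  with values in [0, 1] and mean \<open>pmf p j\<close>.\<close>

lemma (in prob_space) prob_emp_pmf_deviation_le:
  assumes X: "\<And>i. X i \<in> measurable M (count_space UNIV)"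
    and law: "\<And>i. distr M (count_space UNIV) (X i) = measure_pmf p"
    and indep: "indep_vars (\<lambda>_. count_space UNIV) X UNIV"
    and "1 \<le> n" "0 \<le> r"
  shows "prob {\<omega> \<in> space M. r \<le> \<bar>emp_pmf (sample X n \<omega>) j - pmf p j\<bar>} \<le> 2 * exp (- 2 * real n * r\<^sup>2)"
proof -
  let ?f = "\<lambda>i \<omega>. indicator {j} (X i \<omega>) :: real"
  have dist: "distr M borel (?f i) = distr (measure_pmf p) borel (indicator {j})" for i
    unfolding law[of i, symmetric] by (subst distr_distr[OF _ X]) (auto simp: comp_def)
  have "expectation (?f 1) = (\<integral>x. indicator {j} x \<partial>distr M (count_space UNIV) (X 1))"
    by (rule integral_distr[symmetric, OF X]) simp
  then have E: "expectation (?f 1) = pmf p j" by (simp add: law measure_pmf_single)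
  interpret H: Hoeffding_ineq_iid M "{1..n}" ?f "?f 1" 0 1 "expectation (?f 1)"
  proof unfold_locales
    show "indep_vars (\<lambda>_. borel) ?f {1..n}"
      by (rule indep_vars_compose2[OF indep_vars_subset[OF indep]]) auto
    show "random_variable borel (?f 1)" by (rule measurable_compose[OF X]) simp
  qed (auto simp: dist)
  have "prob {\<omega> \<in> space M. r \<le> \<bar>(\<Sum>i\<in>{1..n}. ?f i \<omega>) / real (card {1..n}) - expectation (?f 1)\<bar>}
      \<le> 2 * exp (- 2 * real (card {1..n}) * r\<^sup>2 / (1 - 0)\<^sup>2)"
    by (rule H.Hoeffding_ineq_abs_ge') (use assms in auto)
  then show ?thesis by (simp add: emp_pmf_sample E[unfolded One_nat_def])
qed

theorem theorem2:
  fixes M :: "'a measure" and X :: "nat \<Rightarrow> 'a \<Rightarrow> nat" and p0 :: "nat pmf"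
    and S :: nat and v :: "nat \<Rightarrow> real"
  assumes "prob_space M"
    and "S > 0" and "set_pmf p0 = {0..S}" and "convex_pmf p0"
    and "\<And>i. X i \<in> measurable M (count_space UNIV)"
    and "\<And>i. distr M (count_space UNIV) (X i) = measure_pmf p0"
    and "prob_space.indep_vars M (\<lambda>_. count_space UNIV) X UNIV"
    and "\<And>n. v n > 0" and "v \<longlonglongrightarrow> 0"
    and "filterlim (\<lambda>n. sqrt (real n) * v n) at_top sequentially"
  shows "(\<forall>n\<ge>1. \<forall>\<omega>\<in>space M. \<forall>g.
            \<exists>!f. is_proj (sample_max (sample X n \<omega>) + 2) (Kn (sample X n \<omega>) (v n)) g f)
       \<and> (\<forall>n\<ge>1. (\<lambda>(\<omega>, g). proj (sample_max (sample X n \<omega>) + 2) (Kn (sample X n \<omega>) (v n)) g)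
            \<in> measurable (M \<Otimes>\<^sub>M PiM UNIV (\<lambda>_. (borel :: real measure))) (PiM UNIV (\<lambda>_. (borel :: real measure))))
       \<and> (\<forall>n\<ge>1. (\<lambda>(\<omega>, g). Tn (sample X n \<omega>) (v n) g)
            \<in> borel_measurable (M \<Otimes>\<^sub>M PiM UNIV (\<lambda>_. (borel :: real measure))))
       \<and> tendsto_zero_in_prob M (\<lambda>n \<omega>. cond_BL_dist (sample X n \<omega>) (v n) p0 S)"
proof -
  interpret prob_space M by fact
  note X = assms(5) and law = assms(6) and indep = assms(7)
  let ?xs = "\<lambda>n \<omega>. sample X n \<omega>"
  have sample_meas: "(\<lambda>(\<omega>, g). sample X n \<omega>) \<in> measurable (M \<Otimes>\<^sub>M PiM UNIV (\<lambda>_. (borel :: real measure))) (count_space UNIV)" for n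
    using measurable_compose[OF measurable_fst measurable_map_count_space[OF X]]
    by (simp add: sample_def case_prod_beta' del: upt_Suc)
  have ex1: "\<exists>!f. is_proj (sample_max xs + 2) (Kn xs u) g f" for xs u g
    by (rule closed_midconvex.ex1_proj[OF closed_midconvex_Kn])
  \<comment> \<open>Samples take countably many values, and for each fixed value the projection is
    measurable in \<open>g\<close>; together this gives joint measurability.\<close>
  have meas1: "(\<lambda>(\<omega>, g). proj (sample_max (?xs n \<omega>) + 2) (Kn (?xs n \<omega>) (v n)) g)
      \<in> measurable (M \<Otimes>\<^sub>M PiM UNIV (\<lambda>_. (borel :: real measure))) (PiM UNIV (\<lambda>_. (borel :: real measure)))" for n
    using measurable_compose_countable[OF
        measurable_compose[OF measurable_snd closed_midconvex.measurable_proj[OF closed_midconvex_Kn]] sample_meas]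
    by (simp add: case_prod_beta')
  have meas2: "(\<lambda>(\<omega>, g). Tn (?xs n \<omega>) (v n) g)
      \<in> borel_measurable (M \<Otimes>\<^sub>M PiM UNIV (\<lambda>_. (borel :: real measure)))" for n
    using measurable_compose_countable[OF
        measurable_compose[OF measurable_snd closed_midconvex.measurable_sqdist_proj[OF closed_midconvex_Kn]] sample_meas]
    by (simp add: Tn_def case_prod_beta')
  have "tendsto_zero_in_prob M (\<lambda>n \<omega>. cond_BL_dist (?xs n \<omega>) (v n) p0 S)"
    unfolding tendsto_zero_in_prob_def
  proof (intro allI impI)
    fix \<epsilon> \<delta> :: real assume \<epsilon>: "0 < \<epsilon>" and \<delta>: "0 < \<delta>"
    define C where "C = 12 * (real (S + 2))\<^sup>2 * l1_sq_moment (S + 2)"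
    \<comment> \<open>The largest deviation for which the estimator's second differences are
      guaranteed to err by at most \<open>v n\<close>.\<close>
    define r where "r n = v n / (8 * real (S + 1))" for n
    have r_pos: "0 < r n" for n using assms(8)[of n] by (simp add: r_def)
    have r_lim: "r \<longlonglongrightarrow> 0"
      unfolding r_def using tendsto_divide[OF assms(9) tendsto_const, of "8 * real (S + 1)"] by simp
    have "(\<lambda>n. C * sqrt (r n)) \<longlonglongrightarrow> C * sqrt 0" by (intro tendsto_intros r_lim)
    then have e1: "\<forall>\<^sub>F n in sequentially. C * sqrt (r n) < \<epsilon>"
      using \<epsilon> by (intro order_tendstoD) auto
    have e2: "\<forall>\<^sub>F n in sequentially. r n < 1"
      by (rule order_tendstoD(2)[OF r_lim]) simp
    have "0 < pmf p0 S" using assms(3) by (simp add: pmf_positive_iff)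
    then have e3: "\<forall>\<^sub>F n in sequentially. r n < pmf p0 S" by (rule order_tendstoD(2)[OF r_lim])
    have v2: "(\<lambda>n. 2 * v n) \<longlonglongrightarrow> 2 * 0" by (intro tendsto_intros assms(9))
    \<comment> \<open>A knot has a fixed positive second difference, which \<open>2 * v n\<close>
      eventually undercuts; there are only finitely many candidates in
      \<open>{1..S}\<close>.\<close>
    have "\<forall>\<^sub>F n in sequentially. knot (pmf p0) k \<longrightarrow> 2 * v n < Delta (pmf p0) k" for k
    proof (cases "knot (pmf p0) k")
      case True
      then have "2 * 0 < Delta (pmf p0) k" by (simp add: knot_def)
      from order_tendstoD(2)[OF v2 this] show ?thesis by eventually_elim simp
    qed simp
    then have e4: "\<forall>\<^sub>F n in sequentially. \<forall>k\<in>{1..S}. knot (pmf p0) k \<longrightarrow> 2 * v n < Delta (pmf p0) k"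
      by (intro eventually_ball_finite) auto
    \<comment> \<open>The growth of \<open>sqrt n * v n\<close> enters here: it makes
      \<open>n * (r n)^2\<close> diverge, so the Hoeffding bounds vanish.\<close>
    have "LIM n sequentially. 1 / (8 * real (S + 1)) * (sqrt (real n) * v n) :> at_top"
      by (rule filterlim_tendsto_pos_mult_at_top[OF tendsto_const _ assms(10)]) simp
    then have "LIM n sequentially. (1 / (8 * real (S + 1)) * (sqrt (real n) * v n))\<^sup>2 :> at_top"
      by (intro filterlim_pow_at_top) auto
    then have "LIM n sequentially. - 2 * (1 / (8 * real (S + 1)) * (sqrt (real n) * v n))\<^sup>2 :> at_bot"
      by (intro filterlim_tendsto_neg_mult_at_bot[OF tendsto_const]) auto
    moreover have "(1 / (8 * real (S + 1)) * (sqrt (real n) * v n))\<^sup>2 = real n * (r n)\<^sup>2" for n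
      by (simp add: r_def power_mult_distrib power_divide)
    ultimately have "LIM n sequentially. - 2 * real n * (r n)\<^sup>2 :> at_bot" by (simp add: mult.assoc)
    from filterlim_compose[OF exp_at_bot this]
    have "(\<lambda>n. real (S + 1) * (2 * exp (- 2 * real n * (r n)\<^sup>2))) \<longlonglongrightarrow> real (S + 1) * (2 * 0)"
      by (intro tendsto_intros)
    then have e5: "\<forall>\<^sub>F n in sequentially. real (S + 1) * (2 * exp (- 2 * real n * (r n)\<^sup>2)) < \<delta>"
      by (rule order_tendstoD) (use \<delta> in simp)
    have "\<forall>\<^sub>F n in sequentially. \<exists>A\<in>sets M.
        {\<omega> \<in> space M. \<epsilon> < cond_BL_dist (?xs n \<omega>) (v n) p0 S} \<subseteq> A \<and> prob A < \<delta>"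
      using e1 e2 e3 e4 e5 eventually_ge_at_top[of 1]
    proof eventually_elim
      case (elim n)
      \<comment> \<open>The exceptional event consists of large deviations at some
        \<open>j <= S\<close> and of the null event that some observation leaves the support. It is
        measurable and covers the set whose outer probability is to be bounded.\<close>
      let ?B = "\<lambda>j. {\<omega> \<in> space M. r n \<le> \<bar>emp_pmf (?xs n \<omega>) j - pmf p0 j\<bar>}"
      let ?N = "\<Union>i\<in>{1..n}. {\<omega> \<in> space M. S < X i \<omega>}"
      have N_i: "{\<omega> \<in> space M. S < X i \<omega>} \<in> null_sets M" for i
      proof -
        have "prob {\<omega> \<in> space M. S < X i \<omega>} = measure (distr M (count_space UNIV) (X i)) {S<..}"
          by (subst measure_distr[OF X]) (auto intro!: arg_cong[where f=prob])
        also have "\<dots> = 0" using assms(3) by (auto simp: law measure_pmf_zero_iff)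
        finally show ?thesis
          using measurable_sets[OF X, of "{S<..}" i]
          by (intro null_setsI) (auto simp: emeasure_eq_measure vimage_def Int_def conj_commute)
      qed
      have N: "?N \<in> null_sets M" using N_i by (intro null_sets_UN') auto
      have B: "?B j \<in> sets M" for j
      proof -
        have "?xs n \<in> measurable M (count_space UNIV)"
          unfolding sample_def[abs_def] by (rule measurable_map_count_space[OF X])
        from measurable_sets[OF this, of "{xs. r n \<le> \<bar>emp_pmf xs j - pmf p0 j\<bar>}"]
        show ?thesis by (simp add: vimage_def Int_def conj_commute)
      qed
      have BU: "(\<Union>j\<le>S. ?B j) \<in> sets M" using B by auto
      have "prob (?N \<union> (\<Union>j\<le>S. ?B j)) = prob (\<Union>j\<le>S. ?B j)"
        by (subst Un_commute) (rule measure_Un_null_set[OF BU N])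
      also have "\<dots> \<le> (\<Sum>j\<le>S. prob (?B j))"
        using B by (intro finite_measure_subadditive_finite) auto
      also have "\<dots> \<le> (\<Sum>j\<le>S. 2 * exp (- 2 * real n * (r n)\<^sup>2))"
        using r_pos[of n] elim by (intro sum_mono prob_emp_pmf_deviation_le[OF X law indep]) auto
      also have "\<dots> < \<delta>" using elim by simp
      finally have "prob (?N \<union> (\<Union>j\<le>S. ?B j)) < \<delta>" .
      moreover have "\<not> \<epsilon> < cond_BL_dist (?xs n \<omega>) (v n) p0 S"
        if \<omega>: "\<omega> \<in> space M" "\<omega> \<notin> ?N \<union> (\<Union>j\<le>S. ?B j)" for \<omega>
      proof -
        have "cond_BL_dist (?xs n \<omega>) (v n) p0 S
            \<le> 12 * (real (S + 2))\<^sup>2 * sqrt (r n) * l1_sq_moment (S + 2)"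
        proof (rule cond_BL_dist_le[OF _ _ assms(4,3)])
          show "?xs n \<omega> \<noteq> []" using elim by (simp add: sample_def)
          show "x \<le> S" if "x \<in> set (?xs n \<omega>)" for x
          proof (rule ccontr)
            from that have "x \<in> (\<lambda>i. X i \<omega>) ` {1..n}"
              by (simp add: sample_def atLeastLessThanSuc_atLeastAtMost del: upt_Suc)
            then obtain i where "i \<in> {1..n}" "x = X i \<omega>" by blast
            moreover assume "\<not> x \<le> S"
            ultimately show False using \<omega> by (simp add: not_le)
          qed
          show "\<bar>emp_pmf (?xs n \<omega>) j - pmf p0 j\<bar> < r n" if "j \<le> S" for j
          proof (rule ccontr)
            assume "\<not> \<bar>emp_pmf (?xs n \<omega>) j - pmf p0 j\<bar> < r n"
            then have "\<omega> \<in> ?B j" using \<omega>(1) by simp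
            with \<omega>(2) that show False by blast
          qed
          show "8 * (real (S + 1) * r n) \<le> v n" using assms(8)[of n] by (simp add: r_def field_simps)
        qed (use elim in auto)
        with elim show ?thesis by (simp add: C_def mult.commute mult.left_commute)
      qed
      ultimately show ?case
        by (intro bexI[of _ "?N \<union> (\<Union>j\<le>S. ?B j)"] conjI subsetI sets.Un[OF null_setsD2[OF N] BU]) blast
    qed
    then show "\<exists>N. \<forall>n\<ge>N. \<exists>A\<in>sets M.
        {\<omega> \<in> space M. \<epsilon> < cond_BL_dist (?xs n \<omega>) (v n) p0 S} \<subseteq> A \<and> prob A < \<delta>"
      by (simp add: eventually_sequentially)
  qed
  then show ?thesis by (intro conjI allI impI ballI ex1 meas1 meas2)
qed

end
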